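(* Let $K\ge1$ be an integer, $\varepsilon>0$ and $\beta>\log K$. Let $X$ be a rooted tree such that each vertex has at most $K$ children (finite branches are allowed), equipped with the metric $d_X(x,y)=\int_{[x,y]}e^{-\varepsilon|z|}\,d|z|$ and the measure $d\mu(x)=e^{-\beta|x|}\,d|x|$. Then $(X,d_X,\mu)$ supports a $1$-Poincaré inequality: there is a constant $C>0$ such that for all balls $B=B(x,r)\subset X$, all integrable functions $u$ on $X$ and all upper gradients $g$ of $u$, $$\frac1{\mu(B)}\int_B|u-u_B|\,d\mu\le Cr\,\frac1{\mu(B)}\int_Bg\,d\mu,\qquad\text{where } u_B=\frac1{\mu(B)}\int_Bu\,d\mu.$$
   Context: A rooted tree $X$ is a connected graph without cycles with a distinguished vertex $0$ (the root). The neighbor of a vertex closer to the root is its parent, all other neighbors are its children. Each edge is regarded as an isometric copy of the unit interval, so that $X$ consists of vertices and edge points; $[x,y]$ is the geodesic between $x$ and $y$, $|x|$ is the unweighted distance from $0$ to $x$, and $d|z|$ is the measure giving each edge Lebesgue measure $1$. $B(x,r)=\{y\in X:d_X(x,y)<r\}$. A Borel function $g:X\to[0,\infty]$ is an upper gradient of $u\in L^1_{\rm loc}(X)$ if $|u(z)-u(y)|\le\int_\gamma g\,d_Xs$ whenever $z,y\in X$ and $\gamma$ is the geodesic from $z$ to $y$, where $d_Xs=e^{-\varepsilon|x|}\,d|x|$ denotes arc length with respect to $d_X$. *)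

theory Defs
  imports "HOL-Analysis.Analysis"
begin

section \<open>Rooted trees\<close>

record 'v rooted_graph =
  verts :: "'v set"
  edges :: "('v \<times> 'v) set"
  rootv :: 'v

text \<open>Edges are stored in both directions, so a cycle has at least three distinct vertices.\<close>

definition cycle_in :: "('v \<times> 'v) set \<Rightarrow> 'v list \<Rightarrow> bool" where
  "cycle_in E c \<longleftrightarrow> length c \<ge> 3 \<and> distinct c \<and>
     (\<forall>i. Suc i < length c \<longrightarrow> (c ! i, c ! Suc i) \<in> E) \<and> (last c, hd c) \<in> E"

definition rooted_tree :: "'v rooted_graph \<Rightarrow> bool" where
  "rooted_tree T \<longleftrightarrow>
     rootv T \<in> verts T \<and>
     edges T \<subseteq> verts T \<times> verts T \<and> sym (edges T) \<and> irrefl (edges T) \<and>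
     (\<forall>v\<in>verts T. \<forall>w\<in>verts T. (v, w) \<in> (edges T)\<^sup>*) \<and>
     \<not> (\<exists>c. cycle_in (edges T) c)"

definition gdist :: "'v rooted_graph \<Rightarrow> 'v \<Rightarrow> 'v \<Rightarrow> nat" where
  "gdist T v w = (LEAST n. (v, w) \<in> edges T ^^ n)"

definition parent :: "'v rooted_graph \<Rightarrow> 'v \<Rightarrow> 'v" where
  "parent T v = (THE w. (v, w) \<in> edges T \<and> gdist T (rootv T) w < gdist T (rootv T) v)"

definition children :: "'v rooted_graph \<Rightarrow> 'v \<Rightarrow> 'v set" where
  "children T v = {w. (v, w) \<in> edges T \<and> \<not> gdist T (rootv T) w < gdist T (rootv T) v}"

section \<open>The metric tree\<close>

text \<open>
  The pair \<open>(v, t)\<close> with \<open>v\<close> not the root and \<open>0 < t \<le> 1\<close> is the point at distance \<open>t\<close> from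
  the parent of \<open>v\<close> on the edge joining the parent of \<open>v\<close> to \<open>v\<close>.  Thus \<open>(v, 1)\<close> is the
  vertex \<open>v\<close>; the root is \<open>(rootv T, 1)\<close>, and each point has exactly one such name.
\<close>

definition points :: "'v rooted_graph \<Rightarrow> ('v \<times> real) set" where
  "points T = {(v, t). v \<in> verts T \<and> 0 < t \<and> t \<le> 1 \<and> (v = rootv T \<longrightarrow> t = 1)}"

text \<open>
  The end vertices of the edge carrying a point, each with its distance from that point.
\<close>

fun ends :: "'v rooted_graph \<Rightarrow> 'v \<times> real \<Rightarrow> ('v \<times> real) set" where
  "ends T (v, t) = insert (v, 1 - t) (if v = rootv T then {} else {(parent T v, t)})"

text \<open>The unweighted distance, for which every edge is an isometric copy of the unit interval.\<close>

definition udist :: "'v rooted_graph \<Rightarrow> 'v \<times> real \<Rightarrow> 'v \<times> real \<Rightarrow> real" where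
  "udist T x y =
     (if fst x = fst y then \<bar>snd x - snd y\<bar>
      else Min {a + real (gdist T p q) + b |p a q b. (p, a) \<in> ends T x \<and> (q, b) \<in> ends T y})"

definition height :: "'v rooted_graph \<Rightarrow> 'v \<times> real \<Rightarrow> real" where
  "height T x = udist T (rootv T, 1) x"

definition geodesic_path ::
    "'v rooted_graph \<Rightarrow> 'v \<times> real \<Rightarrow> 'v \<times> real \<Rightarrow> (real \<Rightarrow> 'v \<times> real) \<Rightarrow> bool" where
  "geodesic_path T x y \<gamma> \<longleftrightarrow>
     \<gamma> ` {0..udist T x y} \<subseteq> points T \<and> \<gamma> 0 = x \<and> \<gamma> (udist T x y) = y \<and>
     (\<forall>s\<in>{0..udist T x y}. \<forall>t\<in>{0..udist T x y}. udist T (\<gamma> s) (\<gamma> t) = \<bar>s - t\<bar>)"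

text \<open>In a tree there is exactly one geodesic path from \<open>x\<close> to \<open>y\<close>; this is its image \<open>[x,y]\<close>.\<close>

definition geodesic :: "'v rooted_graph \<Rightarrow> 'v \<times> real \<Rightarrow> 'v \<times> real \<Rightarrow> ('v \<times> real) set" where
  "geodesic T x y = {\<gamma> t |\<gamma> t. geodesic_path T x y \<gamma> \<and> t \<in> {0..udist T x y}}"

text \<open>
  The Borel sigma-algebra of the tree.  On a tree with finitely many children at each vertex,
  the weighted metric \<open>tdist\<close> below induces the same topology as \<open>udist\<close>.
\<close>

definition tborel :: "'v rooted_graph \<Rightarrow> ('v \<times> real) measure" where
  "tborel T = sigma (points T)
     {U. U \<subseteq> points T \<and> (\<forall>x\<in>U. \<exists>e>0. \<forall>y\<in>points T. udist T x y < e \<longrightarrow> y \<in> U)}"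

text \<open>
  The measure \<open>d|z|\<close>.  Edges are indexed by their end vertex farther from the root, and
  \<open>edge_point T v\<close> parametrizes the edge from the parent of \<open>v\<close> to \<open>v\<close>.
\<close>

definition edge_point :: "'v rooted_graph \<Rightarrow> 'v \<Rightarrow> real \<Rightarrow> 'v \<times> real" where
  "edge_point T v t = (if t = 0 then (parent T v, 1) else (v, t))"

definition tlength :: "'v rooted_graph \<Rightarrow> ('v \<times> real) measure" where
  "tlength T =
     distr (count_space (verts T - {rootv T}) \<Otimes>\<^sub>M restrict_space lborel {0..1}) (tborel T)
       (\<lambda>(v, t). edge_point T v t)"

definition tdist :: "'v rooted_graph \<Rightarrow> real \<Rightarrow> 'v \<times> real \<Rightarrow> 'v \<times> real \<Rightarrow> real" where
  "tdist T \<epsilon> x y = (LINT z:geodesic T x y|tlength T. exp (- \<epsilon> * height T z))"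

definition tball :: "'v rooted_graph \<Rightarrow> real \<Rightarrow> 'v \<times> real \<Rightarrow> real \<Rightarrow> ('v \<times> real) set" where
  "tball T \<epsilon> x r = {y \<in> points T. tdist T \<epsilon> x y < r}"

text \<open>
  The measure is completed, so that measurability of integrable functions is meant in the
  Lebesgue sense; upper gradients are Borel.
\<close>

definition tmu :: "'v rooted_graph \<Rightarrow> real \<Rightarrow> ('v \<times> real) measure" where
  "tmu T \<beta> = completion (density (tlength T) (\<lambda>z. ennreal (exp (- \<beta> * height T z))))"

definition upper_gradient ::
    "'v rooted_graph \<Rightarrow> real \<Rightarrow> ('v \<times> real \<Rightarrow> real) \<Rightarrow> ('v \<times> real \<Rightarrow> ennreal) \<Rightarrow> bool" where
  "upper_gradient T \<epsilon> u g \<longleftrightarrow>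
     g \<in> borel_measurable (tborel T) \<and>
     (\<forall>z\<in>points T. \<forall>y\<in>points T.
        ennreal \<bar>u z - u y\<bar>
          \<le> (\<integral>\<^sup>+p\<in>geodesic T z y. (g p * ennreal (exp (- \<epsilon> * height T p))) \<partial>tlength T))"

definition mean_value :: "'a measure \<Rightarrow> 'a set \<Rightarrow> ('a \<Rightarrow> real) \<Rightarrow> real" where
  "mean_value M B u = (LINT z:B|M. u z) / measure M B"

text \<open>
  The integrals on both sides are nonnegative and taken in \<open>[0,\<infinity>]\<close>, because the integral of an
  upper gradient may be infinite.
\<close>

definition supports_1_Poincare :: "'v rooted_graph \<Rightarrow> real \<Rightarrow> real \<Rightarrow> bool" where
  "supports_1_Poincare T \<epsilon> \<beta> \<longleftrightarrow>
     (\<exists>C>0::real. \<forall>x\<in>points T. \<forall>r>0. \<forall>u g.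
        integrable (tmu T \<beta>) u \<longrightarrow> upper_gradient T \<epsilon> u g \<longrightarrow>
        (\<integral>\<^sup>+z\<in>tball T \<epsilon> x r.
            ennreal \<bar>u z - mean_value (tmu T \<beta>) (tball T \<epsilon> x r) u\<bar> \<partial>tmu T \<beta>)
          / emeasure (tmu T \<beta>) (tball T \<epsilon> x r)
        \<le> ennreal (C * r) *
          ((\<integral>\<^sup>+z\<in>tball T \<epsilon> x r. g z \<partial>tmu T \<beta>) / emeasure (tmu T \<beta>) (tball T \<epsilon> x r)))"

end

theory Submission
  imports Defs
begin

text \<open>
  The inequality follows from one choice of comparison value and one exchange of integrals.

  Let \<open>B\<close> be the ball with centre \<open>x\<close> and radius \<open>r\<close>, and let \<open>z\<close> be its top: the point at distance \<open>r\<close>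
  from \<open>x\<close> on the way from \<open>x\<close> to the root, or the root if that is closer (\<open>ball_top\<close>). Every point
  \<open>y\<close> of \<open>B\<close> lies beyond \<open>z\<close>, the geodesic from \<open>z\<close> to \<open>y\<close> stays in \<open>B\<close> except perhaps at \<open>z\<close>, and
  each of its points has distance at most \<open>2 * r\<close> from \<open>y\<close>. Since \<open>\<bar>u y - u z\<bar>\<close> is at most the
  integral of \<open>g\<close> along this geodesic, integrating over \<open>y\<close> and applying Tonelli's theorem leads to
  the integral over \<open>p\<close> in \<open>B\<close> of \<open>g p * exp (- \<epsilon> * hgt p)\<close> times the measure of the set of those
  \<open>y\<close> in \<open>B\<close> that lie beyond \<open>p\<close> (\<open>deviation_from_top\<close>). The centre \<open>x\<close> itself would not do as the
  comparison point: for \<open>p\<close> between \<open>z\<close> and \<open>x\<close>, the points separated from \<open>x\<close> by \<open>p\<close> may have far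
  greater measure than those beyond \<open>p\<close>.

  It remains to bound \<open>exp (- \<epsilon> * hgt p)\<close> times that measure by a constant times
  \<open>r * exp (- \<beta> * hgt p)\<close> (\<open>ball_beyond_measure\<close>). On a single edge, the points beyond \<open>p\<close> within
  distance \<open>2 * r\<close> of \<open>p\<close> have length at most a constant times \<open>r * exp (\<epsilon> * hgt p)\<close>
  (\<open>height_gain\<close>). There are at most \<open>K ^ n\<close> edges \<open>n\<close> generations beyond \<open>p\<close>, and the density there
  has dropped by the factor \<open>exp (- \<beta> * n)\<close>, so the sum over all edges is dominated by a geometric
  series with ratio \<open>K * exp (- \<beta>) < 1\<close> (\<open>weighted_measure_beyond\<close>). Finally, \<open>u z\<close> is replaced by
  the mean value at the cost of a factor two (\<open>mean_value_deviation\<close>).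

  All metric notions reduce to two functions: the height \<open>hgt x\<close>, which is the unweighted distance
  from the root, and the height \<open>meet x y\<close> at which the ways from the root to \<open>x\<close> and to \<open>y\<close>
  separate. The unweighted distance is \<open>hgt x + hgt y - 2 * meet x y\<close> (\<open>udist_eq\<close>), and the weighted
  distance has the same form after the heights are rescaled by \<open>rlen\<close> (\<open>tdist_eq\<close>). Both functions
  are 1-Lipschitz, hence Borel; as there are only countably many edges, this settles all questions of
  measurability.
\<close>

section \<open>Ancestors and graph distance\<close>

lemma distinct_walk:
  assumes "(a, b) \<in> R\<^sup>*"
  shows "\<exists>xs. xs \<noteq> [] \<and> distinct xs \<and> hd xs = a \<and> last xs = b \<and>
           (\<forall>i. Suc i < length xs \<longrightarrow> (xs ! i, xs ! Suc i) \<in> R)"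
  using assms
proof (induction rule: converse_rtrancl_induct)
  case base
  show ?case by (rule exI[of _ "[b]"]) auto
next
  case (step a a')
  then obtain xs where xs: "xs \<noteq> []" "distinct xs" "hd xs = a'" "last xs = b"
    "\<forall>i. Suc i < length xs \<longrightarrow> (xs ! i, xs ! Suc i) \<in> R" by blast
  show ?case
  proof (cases "a \<in> set xs")
    case True
    then obtain k where k: "k < length xs" "xs ! k = a" by (auto simp: in_set_conv_nth)
    \<comment> \<open>the walk returns to \<open>a\<close>: cut off the loop\<close>
    show ?thesis
      using k xs by (intro exI[of _ "drop k xs"]) (auto simp: hd_drop_conv_nth)
  next
    case False
    have "((a # xs) ! i, (a # xs) ! Suc i) \<in> R" if "Suc i < length (a # xs)" for i
      using that xs step.hyps by (cases i) (auto simp: hd_conv_nth)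
    then show ?thesis
      using xs False by (intro exI[of _ "a # xs"]) auto
  qed
qed

locale rtree =
  fixes T :: "'v rooted_graph"
  assumes rooted_tree: "rooted_tree T"
begin

abbreviation "V \<equiv> verts T"
abbreviation "E \<equiv> edges T"
abbreviation "\<rho> \<equiv> rootv T"

definition depth :: "'v \<Rightarrow> nat" where "depth v = gdist T \<rho> v"

text \<open>The ancestor of \<open>v\<close> at depth \<open>n\<close>, meaningful for \<open>n \<le> depth v\<close>.\<close>

definition ancestor :: "'v \<Rightarrow> nat \<Rightarrow> 'v" where
  "ancestor v n = (parent T ^^ (depth v - n)) v"

definition meet_depth :: "'v \<Rightarrow> 'v \<Rightarrow> nat" where
  "meet_depth v w = Max {n. n \<le> depth v \<and> n \<le> depth w \<and> ancestor v n = ancestor w n}"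

lemma root_vert [simp]: "\<rho> \<in> V"
  and edge_verts: "(v, w) \<in> E \<Longrightarrow> v \<in> V \<and> w \<in> V"
  and edge_sym: "(v, w) \<in> E \<Longrightarrow> (w, v) \<in> E"
  and edge_neq: "(v, w) \<in> E \<Longrightarrow> v \<noteq> w"
  and connected: "v \<in> V \<Longrightarrow> w \<in> V \<Longrightarrow> (v, w) \<in> E\<^sup>*"
  and acyclic: "\<not> cycle_in E c"
  using rooted_tree by (auto simp: rooted_tree_def sym_def irrefl_def)

lemma gdist_le: "(v, w) \<in> E ^^ n \<Longrightarrow> gdist T v w \<le> n"
  unfolding gdist_def by (rule Least_le)

lemma gdist_walk: "v \<in> V \<Longrightarrow> w \<in> V \<Longrightarrow> (v, w) \<in> E ^^ gdist T v w"
  unfolding gdist_def using rtrancl_imp_relpow[OF connected] by (metis (mono_tags) LeastI)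

lemma depth_root [simp]: "depth \<rho> = 0"
  using gdist_le[of \<rho> \<rho> 0] by (simp add: depth_def)

lemma depth_0: "v \<in> V \<Longrightarrow> depth v = 0 \<Longrightarrow> v = \<rho>"
  using gdist_walk[of \<rho> v] by (simp add: depth_def)

lemma depth_edge: "(v, w) \<in> E \<Longrightarrow> depth w \<le> Suc (depth v)"
  using gdist_walk[of \<rho> v] edge_verts[of v w] gdist_le[of \<rho> w "Suc (gdist T \<rho> v)"]
  by (auto simp: depth_def)

lemma lower_neighbour_exists:
  assumes "v \<in> V" "v \<noteq> \<rho>"
  shows "\<exists>w. (v, w) \<in> E \<and> Suc (depth w) = depth v"
proof -
  obtain n where n: "depth v = Suc n" using assms depth_0 by (cases "depth v") auto
  have "(\<rho>, v) \<in> E ^^ Suc n" using gdist_walk[of \<rho> v] assms n by (simp add: depth_def)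
  then obtain w where w: "(\<rho>, w) \<in> E ^^ n" "(w, v) \<in> E" by auto
  have "depth w \<le> n" using gdist_le[OF w(1)] by (simp add: depth_def)
  then show ?thesis using depth_edge[OF w(2)] n edge_sym[OF w(2)] by auto
qed

text \<open>A distinct walk from \<open>a\<close> to \<open>b\<close> that avoids their common neighbour \<open>v\<close> closes to a cycle through \<open>v\<close>.\<close>

lemma no_walk_between_neighbours:
  assumes "(v, a) \<in> E" "(v, b) \<in> E" "a \<noteq> b"
  shows "(a, b) \<notin> {(x, y) \<in> E. x \<noteq> v \<and> y \<noteq> v}\<^sup>*"
proof
  assume "(a, b) \<in> {(x, y) \<in> E. x \<noteq> v \<and> y \<noteq> v}\<^sup>*"
  from distinct_walk[OF this] obtain xs where xs: "xs \<noteq> []" "distinct xs" "hd xs = a" "last xs = b"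
    and st: "\<And>i. Suc i < length xs \<Longrightarrow> (xs ! i, xs ! Suc i) \<in> {(x, y) \<in> E. x \<noteq> v \<and> y \<noteq> v}"
    by blast
  have len: "length xs \<ge> 2"
  proof (rule ccontr)
    assume "\<not> ?thesis"
    with xs(1) obtain x where "xs = [x]" by (cases xs; cases "tl xs") auto
    with xs assms show False by auto
  qed
  have "v \<noteq> xs ! i" if "i < length xs" for i
  proof (cases i)
    case 0
    then show ?thesis using xs edge_neq[OF assms(1)] by (auto simp: hd_conv_nth)
  next
    case (Suc k)
    then show ?thesis using st[of k] that by auto
  qed
  then have "v \<notin> set xs" by (auto simp: in_set_conv_nth)
  moreover have "((v # xs) ! i, (v # xs) ! Suc i) \<in> E" if "Suc i < length (v # xs)" for i
    using that xs assms st by (cases i) (auto simp: hd_conv_nth)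
  ultimately have "cycle_in E (v # xs)"
    using xs len edge_sym[OF assms(2)] by (auto simp: cycle_in_def)
  then show False using acyclic by blast
qed

lemma walk_to_root_avoiding:
  assumes "a \<in> V" "depth a \<le> depth v" "a \<noteq> v"
  shows "(a, \<rho>) \<in> {(x, y) \<in> E. x \<noteq> v \<and> y \<noteq> v}\<^sup>*"
  using assms
proof (induction "depth a" arbitrary: a)
  case 0
  then show ?case using depth_0[of a] by auto
next
  case (Suc n)
  then obtain w where w: "(a, w) \<in> E" "Suc (depth w) = depth a"
    using lower_neighbour_exists[of a] by fastforce
  have "(w, \<rho>) \<in> {(x, y) \<in> E. x \<noteq> v \<and> y \<noteq> v}\<^sup>*"
    using Suc w edge_verts[OF w(1)] by (intro Suc.hyps(1)) auto
  moreover have "(a, w) \<in> {(x, y) \<in> E. x \<noteq> v \<and> y \<noteq> v}"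
    using w Suc by auto
  ultimately show ?case by (rule converse_rtrancl_into_rtrancl[rotated])
qed

text \<open>
  Two neighbours of \<open>v\<close> that are not deeper than \<open>v\<close> are joined through the root by a walk that
  avoids \<open>v\<close>; together with \<open>v\<close> it would close up to a cycle.
\<close>

lemma lower_neighbour_unique:
  assumes "(v, a) \<in> E" "(v, b) \<in> E" "depth a \<le> depth v" "depth b \<le> depth v"
  shows "a = b"
proof (rule ccontr)
  assume ne: "a \<noteq> b"
  let ?R = "{(x, y) \<in> E. x \<noteq> v \<and> y \<noteq> v}"
  have "(a, \<rho>) \<in> ?R\<^sup>*" "(b, \<rho>) \<in> ?R\<^sup>*"
    using assms edge_verts edge_neq by (auto intro!: walk_to_root_avoiding)
  moreover have "sym ?R" using edge_sym by (auto simp: sym_def)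
  ultimately have "(a, b) \<in> ?R\<^sup>*" by (meson rtrancl_trans sym_rtrancl symD)
  then show False using no_walk_between_neighbours[OF assms(1,2) ne] by blast
qed

lemma parent_props:
  assumes "v \<in> V" "v \<noteq> \<rho>"
  shows parent_edge: "(v, parent T v) \<in> E"
    and depth_parent: "Suc (depth (parent T v)) = depth v"
    and parent_vert: "parent T v \<in> V"
proof -
  obtain w where w: "(v, w) \<in> E" "Suc (depth w) = depth v"
    using lower_neighbour_exists[OF assms] by blast
  have "parent T v = w"
    unfolding parent_def depth_def[symmetric]
  proof (rule the_equality)
    show "(v, w) \<in> E \<and> depth w < depth v" using w by simp
    show "x = w" if "(v, x) \<in> E \<and> depth x < depth v" for x
      using lower_neighbour_unique[of v x w] w that by simp
  qed
  then show "(v, parent T v) \<in> E" "Suc (depth (parent T v)) = depth v" "parent T v \<in> V"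
    using w edge_verts by auto
qed

lemma edge_cases:
  assumes "(v, w) \<in> E"
  obtains "v \<noteq> \<rho>" "w = parent T v" | "w \<noteq> \<rho>" "v = parent T w"
proof -
  have aux: "v \<noteq> \<rho> \<and> w = parent T v" if e: "(v, w) \<in> E" and d: "depth w \<le> depth v" for v w
  proof -
    have v: "v \<in> V" "w \<in> V" "v \<noteq> w" using e edge_verts edge_neq by auto
    then have "v \<noteq> \<rho>" using d depth_0[of w] by auto
    then show ?thesis
      using lower_neighbour_unique[OF e parent_edge d] depth_parent[of v] v by auto
  qed
  show thesis
    using aux[of v w] aux[of w v] assms edge_sym[of v w] that by (meson nat_le_linear)
qed

lemma children_iff:
  assumes "v \<in> V"
  shows "w \<in> children T v \<longleftrightarrow> w \<in> V \<and> w \<noteq> \<rho> \<and> parent T w = v"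
proof
  assume "w \<in> children T v"
  then have e: "(v, w) \<in> E" and d: "\<not> depth w < depth v" by (auto simp: children_def depth_def)
  then show "w \<in> V \<and> w \<noteq> \<rho> \<and> parent T w = v"
    using edge_verts[OF e] depth_parent[of v] by (cases rule: edge_cases[OF e]) auto
next
  assume "w \<in> V \<and> w \<noteq> \<rho> \<and> parent T w = v"
  then show "w \<in> children T v"
    using parent_edge[of w] depth_parent[of w] edge_sym by (auto simp: children_def depth_def)
qed

lemma ancestor_self [simp]: "ancestor v (depth v) = v"
  by (simp add: ancestor_def)

lemma parent_iterate:
  "v \<in> V \<Longrightarrow> k \<le> depth v \<Longrightarrow>
     (parent T ^^ k) v \<in> V \<and> depth ((parent T ^^ k) v) = depth v - k"
proof (induction k)
  case (Suc k)
  then have "(parent T ^^ k) v \<in> V" "depth ((parent T ^^ k) v) = depth v - k" by auto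
  moreover from this have "(parent T ^^ k) v \<noteq> \<rho>" using Suc.prems by auto
  ultimately show ?case
    using parent_vert[of "(parent T ^^ k) v"] depth_parent[of "(parent T ^^ k) v"] by auto
qed auto

lemma ancestor_vert: "v \<in> V \<Longrightarrow> n \<le> depth v \<Longrightarrow> ancestor v n \<in> V"
  and depth_ancestor: "v \<in> V \<Longrightarrow> n \<le> depth v \<Longrightarrow> depth (ancestor v n) = n"
  using parent_iterate[of v "depth v - n"] by (auto simp: ancestor_def)

lemma ancestor_0: "v \<in> V \<Longrightarrow> ancestor v 0 = \<rho>"
  using ancestor_vert depth_ancestor depth_0 by blast

lemma ancestor_ancestor:
  assumes "v \<in> V" "k \<le> n" "n \<le> depth v"
  shows "ancestor (ancestor v n) k = ancestor v k"
proof -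
  have "depth v - k = (n - k) + (depth v - n)" using assms by simp
  then have "ancestor v k = (parent T ^^ (n - k)) ((parent T ^^ (depth v - n)) v)"
    by (simp only: ancestor_def funpow_add comp_def)
  then show ?thesis using depth_ancestor[of v n] assms by (simp add: ancestor_def)
qed

lemma parent_eq_ancestor:
  assumes "v \<in> V" "v \<noteq> \<rho>"
  shows "parent T v = ancestor v (depth v - 1)"
proof -
  have "depth v - (depth v - 1) = 1" using depth_parent[OF assms] by simp
  then show ?thesis by (simp add: ancestor_def)
qed

lemma ancestor_eq_iff:
  assumes "v \<in> V" "w \<in> V" "n \<le> depth v" "n \<le> depth w"
  shows "ancestor v n = ancestor w n \<longleftrightarrow> n \<le> meet_depth v w"
proof -
  let ?S = "{n. n \<le> depth v \<and> n \<le> depth w \<and> ancestor v n = ancestor w n}"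
  have fin: "finite ?S" by (rule finite_subset[of _ "{..depth v}"]) auto
  have "0 \<in> ?S" using assms ancestor_0 by auto
  then have M: "meet_depth v w \<in> ?S" unfolding meet_depth_def using fin by (intro Max_in) auto
  show ?thesis
  proof
    assume "ancestor v n = ancestor w n"
    then show "n \<le> meet_depth v w" unfolding meet_depth_def using fin assms by (intro Max_ge) auto
  next
    assume "n \<le> meet_depth v w"
    then show "ancestor v n = ancestor w n"
      using M ancestor_ancestor[of v n "meet_depth v w"] ancestor_ancestor[of w n "meet_depth v w"] assms
      by auto
  qed
qed

lemma meet_depth_commute: "meet_depth v w = meet_depth w v"
  unfolding meet_depth_def by (rule arg_cong[of _ _ Max]) auto

lemma meet_depth_le:
  assumes "v \<in> V" "w \<in> V"
  shows "meet_depth v w \<le> depth v" "meet_depth v w \<le> depth w"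
proof -
  let ?S = "{n. n \<le> depth v \<and> n \<le> depth w \<and> ancestor v n = ancestor w n}"
  have "finite ?S" by (rule finite_subset[of _ "{..depth v}"]) auto
  moreover have "0 \<in> ?S" using assms ancestor_0 by auto
  ultimately have "meet_depth v w \<in> ?S" unfolding meet_depth_def by (intro Max_in) auto
  then show "meet_depth v w \<le> depth v" "meet_depth v w \<le> depth w" by auto
qed

lemma meet_depth_self: "v \<in> V \<Longrightarrow> meet_depth v v = depth v"
  using ancestor_eq_iff[of v v "depth v"] meet_depth_le[of v v] by auto

lemma meet_depth_parent:
  assumes "v \<in> V" "w \<in> V" "w \<noteq> \<rho>"
  shows "meet_depth v (parent T w) = min (meet_depth v w) (depth w - 1)"
proof (rule antisym)
  have pw: "parent T w \<in> V" "depth (parent T w) = depth w - 1"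
    using parent_vert[of w] depth_parent[of w] assms by auto
  have anc: "ancestor (parent T w) n = ancestor w n" if "n \<le> depth w - 1" for n
    using parent_eq_ancestor[of w] ancestor_ancestor[of w n "depth w - 1"] that assms by auto
  show "meet_depth v (parent T w) \<le> min (meet_depth v w) (depth w - 1)"
  proof -
    let ?n = "meet_depth v (parent T w)"
    have n: "?n \<le> depth v" "?n \<le> depth w - 1" using meet_depth_le[of v "parent T w"] assms pw by auto
    moreover have "ancestor v ?n = ancestor w ?n"
      using ancestor_eq_iff[of v "parent T w" ?n] n pw assms anc by auto
    ultimately show ?thesis using ancestor_eq_iff[of v w ?n] assms by auto
  qed
  show "min (meet_depth v w) (depth w - 1) \<le> meet_depth v (parent T w)"
  proof -
    let ?n = "min (meet_depth v w) (depth w - 1)"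
    have n: "?n \<le> depth v" "?n \<le> depth w" using meet_depth_le[of v w] assms by auto
    then have "ancestor v ?n = ancestor w ?n" using ancestor_eq_iff[of v w ?n] assms by auto
    then show ?thesis using ancestor_eq_iff[of v "parent T w" ?n] anc[of ?n] n pw assms by auto
  qed
qed

lemma walk_to_ancestor:
  "v \<in> V \<Longrightarrow> k \<le> depth v \<Longrightarrow>
     (v, (parent T ^^ k) v) \<in> E ^^ k \<and> ((parent T ^^ k) v, v) \<in> E ^^ k"
proof (induction k)
  case (Suc k)
  let ?a = "(parent T ^^ k) v"
  have "?a \<in> V" "depth ?a = depth v - k" using Suc parent_iterate[of v k] by auto
  moreover from this have "?a \<noteq> \<rho>" using Suc.prems by auto
  ultimately have e: "(?a, parent T ?a) \<in> E" by (rule_tac parent_edge)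
  then have "(parent T ?a, v) \<in> E ^^ Suc k"
    using Suc edge_sym by (intro relpow_Suc_I2) auto
  then show ?case using Suc e by auto
qed auto

text \<open>
  One edge changes \<open>depth v + depth w - 2 * meet_depth v w\<close> by one, which bounds the length of
  every walk from below; descending to the common ancestor and climbing again attains the bound.
\<close>

lemma gdist_eq:
  assumes "v \<in> V" "w \<in> V"
  shows "gdist T v w + 2 * meet_depth v w = depth v + depth w"
proof (rule antisym)
  let ?n = "meet_depth v w"
  have n: "?n \<le> depth v" "?n \<le> depth w" using meet_depth_le assms by auto
  have "ancestor v ?n = ancestor w ?n" using ancestor_eq_iff[of v w ?n] assms n by auto
  then have "(v, ancestor v ?n) \<in> E ^^ (depth v - ?n)" "(ancestor v ?n, w) \<in> E ^^ (depth w - ?n)"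
    using walk_to_ancestor[of v "depth v - ?n"] walk_to_ancestor[of w "depth w - ?n"] assms
    by (auto simp: ancestor_def)
  then have "(v, w) \<in> E ^^ ((depth v - ?n) + (depth w - ?n))" by (auto simp: relpow_add)
  from gdist_le[OF this] n show "gdist T v w + 2 * ?n \<le> depth v + depth w" by simp
next
  have "depth v + depth w \<le> n + 2 * meet_depth v w \<and> w \<in> V" if "(v, w) \<in> E ^^ n" for n w
    using that
  proof (induction n arbitrary: w)
    case 0
    then show ?case using meet_depth_self[of v] assms by auto
  next
    case (Suc n)
    then obtain u where u: "(v, u) \<in> E ^^ n" "(u, w) \<in> E" by auto
    then have IH: "depth v + depth u \<le> n + 2 * meet_depth v u" "u \<in> V" using Suc.IH by auto
    have w: "w \<in> V" using edge_verts u by auto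
    show ?case
    proof (cases rule: edge_cases[OF u(2)])
      case 1
      then show ?thesis using meet_depth_parent[of v u] meet_depth_le[of v u] depth_parent[of u] IH w assms
        by (auto simp: min_def split: if_splits)
    next
      case 2
      then show ?thesis using meet_depth_parent[of v w] meet_depth_le[of v w] depth_parent[of w] IH w assms
        by (auto simp: min_def split: if_splits)
    qed
  qed
  from this[OF gdist_walk[OF assms]]
  show "depth v + depth w \<le> gdist T v w + 2 * meet_depth v w" by simp
qed

end

section \<open>Points of the metric tree\<close>

context rtree
begin

abbreviation "X \<equiv> points T"

text \<open>
  The formula also gives height \<open>0\<close> to the root, whose name is \<open>(\<rho>, 1)\<close>; so no case distinction is
  needed here or in \<open>point_at\<close>, which is the point at height \<open>s\<close> on the way from the root to \<open>x\<close>.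
\<close>

definition hgt :: "'v \<times> real \<Rightarrow> real" where
  "hgt x = real (depth (fst x)) - 1 + snd x"

definition point_at :: "'v \<times> real \<Rightarrow> real \<Rightarrow> 'v \<times> real" where
  "point_at x s = (ancestor (fst x) (nat \<lceil>s\<rceil>), s - of_int \<lceil>s\<rceil> + 1)"

definition meet :: "'v \<times> real \<Rightarrow> 'v \<times> real \<Rightarrow> real" where
  "meet x y = min (min (hgt x) (hgt y)) (real (meet_depth (fst x) (fst y)))"

lemma points_vert: "x \<in> X \<Longrightarrow> fst x \<in> V"
  by (auto simp: points_def)

lemma point_depth_pos: "x \<in> X \<Longrightarrow> fst x \<noteq> \<rho> \<Longrightarrow> 0 < depth (fst x)"
  using depth_0[of "fst x"] points_vert[of x] by fastforce

lemma hgt_bounds: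
  assumes "x \<in> X"
  shows "real (depth (fst x)) - 1 < hgt x" "hgt x \<le> real (depth (fst x))" "0 \<le> hgt x"
proof -
  have *: "0 < snd x" "snd x \<le> 1" "fst x = \<rho> \<Longrightarrow> snd x = 1"
    using assms by (auto simp: points_def)
  then show "real (depth (fst x)) - 1 < hgt x" "hgt x \<le> real (depth (fst x))"
    by (auto simp: hgt_def)
  show "0 \<le> hgt x"
    using * point_depth_pos[OF assms] by (cases "fst x = \<rho>") (auto simp: hgt_def)
qed

lemma ceiling_hgt: "x \<in> X \<Longrightarrow> \<lceil>hgt x\<rceil> = int (depth (fst x))"
  using hgt_bounds[of x] by (simp add: ceiling_eq_iff)

lemma ceiling_le_depth: "x \<in> X \<Longrightarrow> s \<le> hgt x \<Longrightarrow> nat \<lceil>s\<rceil> \<le> depth (fst x)"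
  using hgt_bounds(2)[of x] by (simp add: nat_le_iff ceiling_le_iff)

lemma point_at_props:
  assumes "x \<in> X" "0 \<le> s" "s \<le> hgt x"
  shows point_at_point: "point_at x s \<in> X" and hgt_point_at: "hgt (point_at x s) = s"
proof -
  have x: "fst x \<in> V" and n: "nat \<lceil>s\<rceil> \<le> depth (fst x)"
    using assms points_vert ceiling_le_depth by auto
  have c: "0 \<le> \<lceil>s\<rceil>" "s \<le> of_int \<lceil>s\<rceil>" "of_int \<lceil>s\<rceil> < s + 1"
    using assms(2) ceiling_correct[of s] by (auto simp: zero_le_ceiling)
  have "s = 0" if "ancestor (fst x) (nat \<lceil>s\<rceil>) = \<rho>"
    using depth_ancestor[OF x n] that c assms(2) by auto
  then show "point_at x s \<in> X"
    using ancestor_vert[OF x n] c by (auto simp: point_at_def points_def)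
  show "hgt (point_at x s) = s"
    using depth_ancestor[OF x n] c by (simp add: point_at_def hgt_def)
qed

lemma point_at_hgt [simp]:
  assumes "x \<in> X"
  shows "point_at x (hgt x) = x"
  using ceiling_hgt[OF assms] by (cases x) (simp add: point_at_def, simp add: hgt_def)

lemma meet_commute: "meet x y = meet y x"
  by (simp add: meet_def meet_depth_commute min.commute)

lemma meet_le: "meet x y \<le> hgt x" "meet x y \<le> hgt y"
  by (auto simp: meet_def)

lemma meet_nonneg: "x \<in> X \<Longrightarrow> y \<in> X \<Longrightarrow> 0 \<le> meet x y"
  using hgt_bounds[of x] hgt_bounds[of y] by (auto simp: meet_def)

lemma meet_self: "x \<in> X \<Longrightarrow> meet x x = hgt x"
  using hgt_bounds[of x] points_vert[of x] by (auto simp: meet_def meet_depth_self)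

text \<open>
  The heights at which the ways from the root to \<open>x\<close> and to \<open>y\<close> agree form an interval with
  maximum \<open>meet x y\<close>. The ultrametric inequality and the shape of geodesics
  follow from this characterization.
\<close>

lemma point_at_eq_iff:
  assumes "x \<in> X" "y \<in> X" "s \<le> hgt x" "s \<le> hgt y" "0 \<le> s"
  shows "point_at x s = point_at y s \<longleftrightarrow> s \<le> meet x y"
proof -
  have "point_at x s = point_at y s \<longleftrightarrow> nat \<lceil>s\<rceil> \<le> meet_depth (fst x) (fst y)"
    using ancestor_eq_iff[of "fst x" "fst y" "nat \<lceil>s\<rceil>"] points_vert ceiling_le_depth assms
    by (simp add: point_at_def)
  also have "\<dots> \<longleftrightarrow> s \<le> real (meet_depth (fst x) (fst y))"
    by (simp add: nat_le_iff ceiling_le_iff)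
  finally show ?thesis using assms by (simp add: meet_def)
qed

lemma point_at_point_at:
  assumes "x \<in> X" "0 \<le> s" "s \<le> t" "t \<le> hgt x"
  shows "point_at (point_at x t) s = point_at x s"
proof -
  have "ancestor (ancestor (fst x) (nat \<lceil>t\<rceil>)) (nat \<lceil>s\<rceil>) = ancestor (fst x) (nat \<lceil>s\<rceil>)"
    using assms points_vert ceiling_le_depth[of x t]
    by (intro ancestor_ancestor nat_mono ceiling_mono) auto
  then show ?thesis by (simp add: point_at_def)
qed

lemma meet_eqI:
  assumes "x \<in> X" "y \<in> X" "m \<le> hgt x" "m \<le> hgt y" "0 \<le> m"
    and "\<And>s. 0 \<le> s \<Longrightarrow> s \<le> hgt x \<Longrightarrow> s \<le> hgt y \<Longrightarrow> point_at x s = point_at y s \<longleftrightarrow> s \<le> m"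
  shows "meet x y = m"
proof (rule antisym)
  show "meet x y \<le> m"
    using assms(6)[of "meet x y"] point_at_eq_iff[of x y "meet x y"] meet_le meet_nonneg assms(1,2)
    by auto
  show "m \<le> meet x y"
    using assms(6)[of m] point_at_eq_iff[of x y m] assms by auto
qed

lemma meet_point_at:
  assumes "x \<in> X" "y \<in> X" "0 \<le> a" "a \<le> hgt x" "0 \<le> b" "b \<le> hgt y"
  shows "meet (point_at x a) (point_at y b) = min (min a b) (meet x y)"
proof (rule meet_eqI)
  show "0 \<le> min (min a b) (meet x y)" using assms meet_nonneg by auto
next
  fix s assume "0 \<le> s" "s \<le> hgt (point_at x a)" "s \<le> hgt (point_at y b)"
  then have s: "0 \<le> s" "s \<le> a" "s \<le> b" using assms hgt_point_at by auto
  then have "point_at (point_at x a) s = point_at x s" "point_at (point_at y b) s = point_at y s"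
    using assms point_at_point_at by auto
  then show "point_at (point_at x a) s = point_at (point_at y b) s \<longleftrightarrow> s \<le> min (min a b) (meet x y)"
    using point_at_eq_iff[of x y s] s assms by auto
qed (use assms point_at_point hgt_point_at in auto)

lemma meet_ultrametric:
  assumes "x \<in> X" "y \<in> X" "z \<in> X"
  shows "min (meet x y) (meet y z) \<le> meet x z"
proof -
  let ?s = "min (meet x y) (meet y z)"
  have s: "0 \<le> ?s" "?s \<le> hgt x" "?s \<le> hgt y" "?s \<le> hgt z"
    using meet_nonneg assms meet_le[of x y] meet_le[of y z] by (auto simp: min_le_iff_disj)
  have "point_at x ?s = point_at y ?s" "point_at y ?s = point_at z ?s"
    using point_at_eq_iff[of x y ?s] point_at_eq_iff[of y z ?s] s assms by auto
  then show ?thesis using point_at_eq_iff[of x z ?s] s assms by auto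
qed

text \<open>
  The condition \<open>meet p y = hgt p\<close>, which says that \<open>y\<close> lies beyond \<open>p\<close> in the tree order, is used
  throughout in this form because both sides are measurable functions of the points.
\<close>

lemma below_iff:
  assumes "p \<in> X" "y \<in> X"
  shows "meet p y = hgt p \<longleftrightarrow> hgt p \<le> hgt y \<and> p = point_at y (hgt p)"
  using point_at_eq_iff[of p y "hgt p"] meet_le[of p y] hgt_bounds[of p] assms by auto

subsection \<open>The unweighted distance and its geodesics\<close>

lemma ends_finite: "finite (ends T x)"
  by (cases x) auto

text \<open>
  Between different edges the minimum over end vertices is attained at the parents, except
  when the edge of one point lies on the way to the other point.
\<close>

lemma udist_eq:
  assumes "x \<in> X" "y \<in> X"
  shows "udist T x y = hgt x + hgt y - 2 * meet x y"
proof -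
  obtain v t w s where xy: "x = (v, t)" "y = (w, s)" by (cases x; cases y) auto
  have v: "v \<in> V" "0 < t" "t \<le> 1" "v = \<rho> \<Longrightarrow> t = 1" and w: "w \<in> V" "0 < s" "s \<le> 1" "w = \<rho> \<Longrightarrow> s = 1"
    using assms xy by (auto simp: points_def)
  show ?thesis
  proof (cases "v = w")
    case True
    have "meet x y = min (hgt x) (hgt y)"
      using True xy meet_depth_self[OF v(1)] hgt_bounds[OF assms(1)] by (auto simp: meet_def)
    then show ?thesis using True xy by (auto simp: udist_def hgt_def min_def)
  next
    case False
    let ?S = "{a + real (gdist T p q) + b |p a q b. (p, a) \<in> ends T x \<and> (q, b) \<in> ends T y}"
    have S: "?S = (\<lambda>((p, a), (q, b)). a + real (gdist T p q) + b) ` (ends T x \<times> ends T y)"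
      by force
    then have fin: "finite ?S" by (simp add: ends_finite)
    have g: "real (gdist T p q) = real (depth p) + real (depth q) - 2 * real (meet_depth p q)"
      if "p \<in> V" "q \<in> V" for p q
      using gdist_eq[OF that] by linarith
    have pv: "parent T v \<in> V" "real (depth (parent T v)) = real (depth v) - 1" "1 \<le> depth v"
        "meet_depth (parent T v) q = min (meet_depth v q) (depth v - 1)"
      if "v \<noteq> \<rho>" "q \<in> V" for q
      using parent_vert[of v] depth_parent[of v] meet_depth_parent[of q v] v that
      by (auto simp: meet_depth_commute)
    have pw: "parent T w \<in> V" "real (depth (parent T w)) = real (depth w) - 1" "1 \<le> depth w"
        "meet_depth q (parent T w) = min (meet_depth q w) (depth w - 1)"
      if "w \<noteq> \<rho>" "q \<in> V" for q
      using parent_vert[of w] depth_parent[of w] meet_depth_parent[of q w] w that by auto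
    let ?N = "meet_depth v w"
    have N: "?N \<le> depth v" "?N \<le> depth w" using meet_depth_le v w by auto
    have not_both: "\<not> (?N = depth v \<and> ?N = depth w)"
      using ancestor_eq_iff[of v w ?N] v w False by (metis ancestor_self order_refl)
    have h: "hgt x = real (depth v) - 1 + t" "hgt y = real (depth w) - 1 + s"
      using xy by (auto simp: hgt_def)
    have pos: "0 < depth v" if "v \<noteq> \<rho>" using depth_0[OF v(1)] that by auto
    have pos': "0 < depth w" if "w \<noteq> \<rho>" using depth_0[OF w(1)] that by auto
    have m: "meet x y = min (min (real (depth v) - 1 + t) (real (depth w) - 1 + s)) (real ?N)"
      using h xy by (simp add: meet_def)
    let ?R = "hgt x + hgt y - 2 * meet x y"
    have "Min ?S = ?R"
    proof (rule Min_eqI[OF fin])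
      fix d assume "d \<in> ?S"
      then obtain p a q b where pq: "(p, a) \<in> ends T x" "(q, b) \<in> ends T y"
        and d: "d = a + real (gdist T p q) + b" by blast
      consider "p = v" "a = 1 - t" "q = w" "b = 1 - s"
        | "v \<noteq> \<rho>" "p = parent T v" "a = t" "q = w" "b = 1 - s"
        | "w \<noteq> \<rho>" "p = v" "a = 1 - t" "q = parent T w" "b = s"
        | "v \<noteq> \<rho>" "w \<noteq> \<rho>" "p = parent T v" "a = t" "q = parent T w" "b = s"
        using pq xy by (auto split: if_splits)
      then show "?R \<le> d"
      proof cases
        case 1
        then show ?thesis using d g[OF v(1) w(1)] v w N m h by (auto simp: min_def)
      next
        case 2
        then show ?thesis using d g[of "parent T v" w] pv[of w] v w N m h pos
          by (auto simp: min_def of_nat_diff split: if_splits)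
      next
        case 3
        then show ?thesis using d g[of v "parent T w"] pw[of v] v w N m h pos'
          by (auto simp: min_def of_nat_diff split: if_splits)
      next
        case 4
        then show ?thesis
          using d g[of "parent T v" "parent T w"] pv(1,2) pv(4)[of "parent T w"] pw[of v] v w N m h pos pos'
          by (auto simp: min_def of_nat_diff split: if_splits)
      qed
    next
      have ev: "(v, 1 - t) \<in> ends T x" "v \<noteq> \<rho> \<Longrightarrow> (parent T v, t) \<in> ends T x"
        and ew: "(w, 1 - s) \<in> ends T y" "w \<noteq> \<rho> \<Longrightarrow> (parent T w, s) \<in> ends T y"
        using xy by auto
      consider "?N = depth v" "?N < depth w" | "?N = depth w" "?N < depth v"
        | "?N < depth v" "?N < depth w"
        using N not_both by linarith
      then have "\<exists>p a q b. (p, a) \<in> ends T x \<and> (q, b) \<in> ends T y \<and> ?R = a + real (gdist T p q) + b"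
      proof cases
        case 1
        then have wr: "w \<noteq> \<rho>" by auto
        then have "?R = (1 - t) + real (gdist T v (parent T w)) + s"
          using 1 g[of v "parent T w"] pw[of v] v w m h by (auto simp: min_def of_nat_diff)
        then show ?thesis using ev(1) ew(2)[OF wr] by blast
      next
        case 2
        then have vr: "v \<noteq> \<rho>" by auto
        then have "?R = t + real (gdist T (parent T v) w) + (1 - s)"
          using 2 g[of "parent T v" w] pv[of w] v w m h by (auto simp: min_def of_nat_diff)
        then show ?thesis using ev(2)[OF vr] ew(1) by blast
      next
        case 3
        then have r: "v \<noteq> \<rho>" "w \<noteq> \<rho>" by auto
        have N': "?N \<le> depth v - 1" "?N \<le> depth w - 1" using 3 by auto
        have "meet_depth (parent T v) (parent T w) = ?N"
          using pv(4)[OF r(1)] pw[OF r(2), of v] v w N' by (simp add: min_absorb1)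
        moreover have "meet x y = real ?N"
          unfolding m using 3 v w by (intro min_absorb2) (auto simp: min_def)
        ultimately have "?R = t + real (gdist T (parent T v) (parent T w)) + s"
          using g[of "parent T v" "parent T w"] pv(1,2)[OF r(1) w(1)] pw(1,2)[OF r(2) v(1)] h by simp
        then show ?thesis using ev(2)[OF r(1)] ew(2)[OF r(2)] by blast
      qed
      then show "?R \<in> ?S" by blast
    qed
    then show ?thesis using False xy by (simp add: udist_def)
  qed
qed

lemma root_point: "(\<rho>, 1) \<in> X"
  by (simp add: points_def)

lemma hgt_root: "hgt (\<rho>, 1) = 0"
  by (simp add: hgt_def)

lemma height_eq:
  assumes "x \<in> X"
  shows "height T x = hgt x"
proof -
  have "meet (\<rho>, 1) x = 0"
    using meet_nonneg[OF root_point assms] meet_le(1)[of "(\<rho>, 1)" x] hgt_root by auto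
  then show ?thesis using udist_eq[OF root_point assms] hgt_root by (simp add: height_def)
qed

text \<open>Descend from \<open>x\<close> to the height of the meet, then climb to \<open>y\<close>.\<close>

lemma geodesic_path_exists:
  assumes "x \<in> X" "y \<in> X"
  shows "geodesic_path T x y
     (\<lambda>s. if s \<le> hgt x - meet x y then point_at x (hgt x - s)
          else point_at y (s - hgt x + 2 * meet x y))"
    (is "geodesic_path T x y ?\<gamma>")
proof -
  let ?m = "meet x y"
  let ?d = "hgt x + hgt y - 2 * ?m"
  have m: "0 \<le> ?m" "?m \<le> hgt x" "?m \<le> hgt y" using meet_nonneg meet_le assms by auto
  have in_X: "?\<gamma> s \<in> X" if "s \<in> {0..?d}" for s
    using that m assms by (auto intro!: point_at_point)
  have ud: "udist T (?\<gamma> s) (?\<gamma> t) = \<bar>s - t\<bar>" if "s \<in> {0..?d}" "t \<in> {0..?d}" for s t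
  proof -
    have yx: "meet y x = ?m" by (rule meet_commute)
    have "udist T (?\<gamma> s) (?\<gamma> t) = hgt (?\<gamma> s) + hgt (?\<gamma> t) - 2 * meet (?\<gamma> s) (?\<gamma> t)"
      by (rule udist_eq[OF in_X[OF that(1)] in_X[OF that(2)]])
    also have "\<dots> = \<bar>s - t\<bar>"
    proof (cases "s \<le> hgt x - ?m"; cases "t \<le> hgt x - ?m")
      assume "s \<le> hgt x - ?m" "t \<le> hgt x - ?m"
      then show ?thesis using that m assms
        by (simp add: hgt_point_at meet_point_at meet_self min_def)
    next
      assume "s \<le> hgt x - ?m" "\<not> t \<le> hgt x - ?m"
      then show ?thesis using that m assms
        by (simp add: hgt_point_at meet_point_at)
    next
      assume "\<not> s \<le> hgt x - ?m" "t \<le> hgt x - ?m"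
      then show ?thesis using that m assms
        by (simp add: hgt_point_at meet_point_at yx)
    next
      assume "\<not> s \<le> hgt x - ?m" "\<not> t \<le> hgt x - ?m"
      then show ?thesis using that m assms
        by (simp add: hgt_point_at meet_point_at meet_self min_def)
    qed
    finally show ?thesis .
  qed
  have \<gamma>0: "?\<gamma> 0 = x" using m assms by simp
  have \<gamma>1: "?\<gamma> ?d = y"
  proof (cases "hgt y = ?m")
    case True
    then have "point_at x ?m = y" using below_iff[of y x] assms by (simp add: meet_commute)
    then show ?thesis using True by simp
  next
    case False
    then show ?thesis using m assms by simp
  qed
  show ?thesis
    unfolding geodesic_path_def udist_eq[OF assms]
    using in_X ud \<gamma>0 \<gamma>1 by blast
qed

text \<open>
  A point \<open>p\<close> of a geodesic splits its length, and in terms of heights this forces \<open>p\<close> to lie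
  above the meet on the way to \<open>x\<close> or on the way to \<open>y\<close>.
\<close>

lemma geodesic_eq:
  assumes "x \<in> X" "y \<in> X"
  shows "geodesic T x y = {p \<in> X. meet x y \<le> hgt p \<and> (meet p x = hgt p \<or> meet p y = hgt p)}"
proof (intro subset_antisym subsetI)
  fix p assume "p \<in> geodesic T x y"
  then obtain \<gamma> t where \<gamma>: "geodesic_path T x y \<gamma>" and t: "t \<in> {0..udist T x y}" and p: "p = \<gamma> t"
    by (auto simp: geodesic_def)
  let ?d = "udist T x y"
  have d: "0 \<in> {0..?d}" "?d \<in> {0..?d}" using t by auto
  have p': "p \<in> X" and xp: "udist T x p = t" and py: "udist T p y = ?d - t"
  proof -
    have ends: "\<gamma> 0 = x" "\<gamma> ?d = y" "\<gamma> t \<in> X"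
      and iso: "udist T (\<gamma> s) (\<gamma> s') = \<bar>s - s'\<bar>" if "s \<in> {0..?d}" "s' \<in> {0..?d}" for s s'
      using \<gamma> t that by (auto simp: geodesic_path_def)
    show "p \<in> X" "udist T x p = t" "udist T p y = ?d - t"
      using ends[OF d] iso[OF d(1) t] iso[OF t d(2)] t p by auto
  qed
  have "udist T x p + udist T p y = ?d" using xp py by simp
  then have "hgt p + meet x y = meet p x + meet p y"
    using udist_eq[OF assms(1) p'] udist_eq[OF p' assms(2)] udist_eq[OF assms] meet_commute[of p x]
    by simp
  moreover have "min (meet p x) (meet p y) \<le> meet x y"
    using meet_ultrametric[OF assms(1) p' assms(2)] meet_commute[of p x] by simp
  ultimately show "p \<in> {p \<in> X. meet x y \<le> hgt p \<and> (meet p x = hgt p \<or> meet p y = hgt p)}"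
    using p' meet_le(1)[of p x] meet_le(1)[of p y] by (auto simp: min_def split: if_splits)
next
  fix p assume "p \<in> {p \<in> X. meet x y \<le> hgt p \<and> (meet p x = hgt p \<or> meet p y = hgt p)}"
  then have p: "p \<in> X" "meet x y \<le> hgt p" and "meet p x = hgt p \<or> meet p y = hgt p" by auto
  let ?\<gamma> = "\<lambda>s. if s \<le> hgt x - meet x y then point_at x (hgt x - s)
          else point_at y (s - hgt x + 2 * meet x y)"
  from \<open>meet p x = hgt p \<or> meet p y = hgt p\<close>
  have "\<exists>t\<in>{0..udist T x y}. p = ?\<gamma> t"
  proof
    assume "meet p x = hgt p"
    then have "hgt p \<le> hgt x" "p = point_at x (hgt p)" using below_iff p assms by auto
    then show ?thesis
      using p meet_le[of x y] udist_eq[OF assms] by (intro bexI[of _ "hgt x - hgt p"]) auto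
  next
    assume "meet p y = hgt p"
    then have y: "hgt p \<le> hgt y" "p = point_at y (hgt p)" using below_iff p assms by auto
    show ?thesis
    proof (cases "hgt p = meet x y")
      case True
      have "point_at x (meet x y) = point_at y (meet x y)"
        using point_at_eq_iff[of x y "meet x y"] meet_le meet_nonneg assms by auto
      then have "p = point_at x (hgt p)" using y True by simp
      then show ?thesis
        using p True meet_le[of x y] udist_eq[OF assms] by (intro bexI[of _ "hgt x - hgt p"]) auto
    next
      case False
      then show ?thesis
        using p y meet_le[of x y] udist_eq[OF assms]
        by (intro bexI[of _ "hgt p + hgt x - 2 * meet x y"]) auto
    qed
  qed
  then show "p \<in> geodesic T x y"
    using geodesic_path_exists[OF assms]
    unfolding geodesic_def mem_Collect_eq by (auto intro!: exI[of _ ?\<gamma>])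
qed

end

section \<open>The Borel structure and the length measure\<close>

context rtree
begin

lemma space_tborel [simp]: "space (tborel T) = X"
  unfolding tborel_def by (rule space_measure_of) auto

lemma open_in_tborel:
  assumes "U \<subseteq> X" "\<And>x. x \<in> U \<Longrightarrow> \<exists>e>0. \<forall>y\<in>X. udist T x y < e \<longrightarrow> y \<in> U"
  shows "U \<in> sets (tborel T)"
proof -
  let ?\<U> = "{U. U \<subseteq> X \<and> (\<forall>x\<in>U. \<exists>e>0. \<forall>y\<in>X. udist T x y < e \<longrightarrow> y \<in> U)}"
  have "U \<in> ?\<U>" using assms by auto
  then have "U \<in> sigma_sets X ?\<U>" by (rule sigma_sets.Basic)
  then show ?thesis unfolding tborel_def by (subst sets_measure_of) auto
qed

lemma lipschitz_measurable:
  fixes f :: "'v \<times> real \<Rightarrow> real"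
  assumes "\<And>x y. x \<in> X \<Longrightarrow> y \<in> X \<Longrightarrow> \<bar>f x - f y\<bar> \<le> udist T x y"
  shows "f \<in> borel_measurable (tborel T)"
proof (rule borel_measurableI)
  fix S :: "real set" assume "open S"
  show "f -` S \<inter> space (tborel T) \<in> sets (tborel T)"
  proof (rule open_in_tborel)
    fix x assume x: "x \<in> f -` S \<inter> space (tborel T)"
    then obtain e where e: "e > 0" "ball (f x) e \<subseteq> S" using \<open>open S\<close> by (auto elim: openE)
    have "y \<in> f -` S \<inter> space (tborel T)" if "y \<in> X" "udist T x y < e" for y
      using assms[of x y] x that e(2) by (auto simp: dist_real_def intro!: subsetD[OF e(2)])
    then show "\<exists>e>0. \<forall>y\<in>X. udist T x y < e \<longrightarrow> y \<in> f -` S \<inter> space (tborel T)"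
      using e(1) by blast
  qed auto
qed

lemma hgt_measurable [measurable]: "hgt \<in> borel_measurable (tborel T)"
proof (rule lipschitz_measurable)
  fix x y assume "x \<in> X" "y \<in> X"
  then show "\<bar>hgt x - hgt y\<bar> \<le> udist T x y"
    using udist_eq[of x y] meet_le[of x y] by simp
qed

lemma meet_measurable [measurable]:
  assumes "z \<in> X"
  shows "meet z \<in> borel_measurable (tborel T)"
proof (rule lipschitz_measurable)
  fix x y assume "x \<in> X" "y \<in> X"
  then show "\<bar>meet z x - meet z y\<bar> \<le> udist T x y"
    using udist_eq[of x y] meet_le[of x y] meet_le[of z x] meet_le[of z y] assms
      meet_ultrametric[of z x y] meet_ultrametric[of z y x] meet_commute[of x y]
    by (auto simp: min_def split: if_splits)
qed

lemma height_measurable [measurable]: "height T \<in> borel_measurable (tborel T)"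
  using hgt_measurable by (rule measurable_cong[THEN iffD1, rotated]) (simp add: height_eq)

lemma vert_point: "v \<in> V \<Longrightarrow> (v, 1) \<in> X" and hgt_vert: "hgt (v, 1) = depth v"
  by (auto simp: points_def hgt_def)

text \<open>
  The case distinction in \<open>edge_point\<close> between the parent end and the other points disappears when
  the edge is seen as a piece of the way from the root to \<open>v\<close>.
\<close>

lemma edge_point_eq:
  assumes "v \<in> V" "v \<noteq> \<rho>" "0 \<le> t" "t \<le> 1"
  shows "edge_point T v t = point_at (v, 1) (real (depth v) - 1 + t)"
proof (cases "t = 0")
  case True
  have "1 \<le> depth v" using depth_parent[OF assms(1,2)] by simp
  then have "real (depth v) - 1 = real (depth v - 1)" by simp
  then show ?thesis
    using True parent_eq_ancestor[OF assms(1,2)]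
    by (simp add: edge_point_def point_at_def del: of_nat_diff)
next
  case False
  then have "\<lceil>real (depth v) - 1 + t\<rceil> = int (depth v)" using assms by (simp add: ceiling_eq_iff)
  then show ?thesis using False by (simp add: edge_point_def point_at_def)
qed

lemma edge_point_udist:
  assumes v: "v \<in> V" "v \<noteq> \<rho>" and s: "0 \<le> s" "s \<le> 1" and t: "0 \<le> t" "t \<le> 1"
  shows "edge_point T v t \<in> X" "udist T (edge_point T v s) (edge_point T v t) = \<bar>s - t\<bar>"
proof -
  have d: "1 \<le> depth v" using depth_parent[OF v] by simp
  have X: "edge_point T v t \<in> X" if "0 \<le> t" "t \<le> 1" for t
    unfolding edge_point_eq[OF v that] using v d that by (intro point_at_point vert_point) (auto simp: hgt_vert)
  then show "edge_point T v t \<in> X" using t .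
  have "hgt (edge_point T v s) = real (depth v) - 1 + s" "hgt (edge_point T v t) = real (depth v) - 1 + t"
    "meet (edge_point T v s) (edge_point T v t) = real (depth v) - 1 + min s t"
    unfolding edge_point_eq[OF v s] edge_point_eq[OF v t]
    using v d s t by (auto simp: hgt_point_at meet_point_at vert_point hgt_vert meet_self min_def)
  then show "udist T (edge_point T v s) (edge_point T v t) = \<bar>s - t\<bar>"
    using udist_eq[OF X[OF s] X[OF t]] by (auto simp: min_def)
qed

lemma edge_point_measurable:
  assumes v: "v \<in> V" "v \<noteq> \<rho>"
  shows "edge_point T v \<in> restrict_space lborel {0..1} \<rightarrow>\<^sub>M tborel T"
  unfolding tborel_def
proof (rule measurable_measure_of)
  show "edge_point T v \<in> space (restrict_space lborel {0..1}) \<rightarrow> X"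
    using edge_point_udist(1)[OF v] by (auto simp: space_restrict_space)
next
  fix U assume "U \<in> {U. U \<subseteq> X \<and> (\<forall>x\<in>U. \<exists>e>0. \<forall>y\<in>X. udist T x y < e \<longrightarrow> y \<in> U)}"
  then have U: "U \<subseteq> X" "\<And>x. x \<in> U \<Longrightarrow> \<exists>e>0. \<forall>y\<in>X. udist T x y < e \<longrightarrow> y \<in> U" by auto
  let ?P = "edge_point T v -` U \<inter> {0..1}"
  define W where "W = \<Union>{S. open S \<and> S \<inter> {0..1} \<subseteq> ?P}"
  have "?P \<subseteq> W"
  proof
    fix s assume s: "s \<in> ?P"
    then obtain e where e: "e > 0" "\<And>y. y \<in> X \<Longrightarrow> udist T (edge_point T v s) y < e \<Longrightarrow> y \<in> U"
      using U(2)[of "edge_point T v s"] by auto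
    have "edge_point T v t \<in> U" if "dist s t < e" "0 \<le> t" "t \<le> 1" for t
      using e(2)[of "edge_point T v t"] edge_point_udist[OF v, of s t] s that
      by (simp add: dist_real_def)
    then have "ball s e \<inter> {0..1} \<subseteq> ?P" by auto
    then show "s \<in> W" unfolding W_def using e(1) by (intro UnionI[of "ball s e"]) auto
  qed
  then have P: "?P = W \<inter> {0..1}" unfolding W_def by blast
  have "open W" by (auto simp: W_def)
  then have "W \<inter> {0..1} \<in> sets borel" by (intro sets.Int) auto
  then have "?P \<in> sets (restrict_space lborel {0..1})"
    unfolding P by (simp add: sets_restrict_space_iff)
  then show "edge_point T v -` U \<inter> space (restrict_space lborel {0..1}) \<in> sets (restrict_space lborel {0..1})"
    by (simp add: space_restrict_space)
qed auto

end

subsection \<open>Trees with at most \<open>K\<close> children at each vertex\<close>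

locale bounded_tree = rtree T for T :: "'v rooted_graph" +
  fixes K :: nat
  assumes K_pos: "K \<ge> 1"
    and children_bound: "v \<in> V \<Longrightarrow> finite (children T v) \<and> card (children T v) \<le> K"
begin

definition descendants :: "'v \<Rightarrow> nat \<Rightarrow> 'v set" where
  "descendants v n = {w \<in> V. depth w = depth v + n \<and> ancestor w (depth v) = v}"

lemma descendants_Suc:
  assumes "v \<in> V"
  shows "descendants v (Suc n) \<subseteq> (\<Union>u\<in>descendants v n. children T u)"
proof
  fix w assume "w \<in> descendants v (Suc n)"
  then have w: "w \<in> V" "depth w = Suc (depth v + n)" "ancestor w (depth v) = v"
    by (auto simp: descendants_def)
  then have "w \<noteq> \<rho>" by auto
  then have p: "parent T w \<in> V" "depth (parent T w) = depth v + n" "parent T w = ancestor w (depth v + n)"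
    using parent_vert[of w] depth_parent[of w] parent_eq_ancestor[of w] w by auto
  then have "ancestor (parent T w) (depth v) = v"
    using ancestor_ancestor[of w "depth v" "depth v + n"] w by auto
  then have "parent T w \<in> descendants v n" using p by (auto simp: descendants_def)
  moreover have "w \<in> children T (parent T w)" using p \<open>w \<noteq> \<rho>\<close> w by (simp add: children_iff)
  ultimately show "w \<in> (\<Union>u\<in>descendants v n. children T u)" by blast
qed

lemma descendants_card:
  assumes "v \<in> V"
  shows "finite (descendants v n) \<and> card (descendants v n) \<le> K ^ n"
proof (induction n)
  case 0
  have "descendants v 0 \<subseteq> {v}" by (auto simp: descendants_def) (metis ancestor_self)
  then show ?case using card_mono[of "{v}" "descendants v 0"] finite_subset by auto
next
  case (Suc n)
  have ch: "finite (children T u)" "card (children T u) \<le> K" if "u \<in> descendants v n" for u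
    using children_bound[of u] that by (auto simp: descendants_def)
  then have fin: "finite (\<Union>u\<in>descendants v n. children T u)" using Suc by auto
  have "card (descendants v (Suc n)) \<le> card (\<Union>u\<in>descendants v n. children T u)"
    by (rule card_mono[OF fin descendants_Suc[OF assms]])
  also have "\<dots> \<le> (\<Sum>u\<in>descendants v n. card (children T u))" using Suc by (intro card_UN_le) auto
  also have "\<dots> \<le> of_nat (card (descendants v n)) * K" using ch by (intro sum_bounded_above) auto
  also have "\<dots> \<le> K ^ Suc n" using Suc by simp
  finally show ?case using finite_subset[OF descendants_Suc[OF assms] fin] by simp
qed

lemma countable_V: "countable V"
proof -
  have "V \<subseteq> (\<Union>n. descendants \<rho> n)"
    using ancestor_0 by (auto simp: descendants_def)
  moreover have "countable (\<Union>n. descendants \<rho> n)"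
    using descendants_card[of \<rho>] by (intro countable_UN) (auto simp: countable_finite)
  ultimately show ?thesis by (rule countable_subset)
qed

abbreviation "I01 \<equiv> restrict_space lborel {0..1::real}"

lemma edge_map_measurable:
  "(\<lambda>(v, t). edge_point T v t) \<in> count_space (V - {\<rho>}) \<Otimes>\<^sub>M I01 \<rightarrow>\<^sub>M tborel T"
  using countable_V edge_point_measurable by (intro measurable_pair_measure_countable1) auto

lemma sets_tlength [measurable_cong]: "sets (tlength T) = sets (tborel T)"
  and space_tlength [simp]: "space (tlength T) = X"
  by (auto simp: tlength_def)

text \<open>
  Integration over the tree is integration over the edges; the parent end of each edge is a
  null set and may be left out, which makes \<open>(v, t)\<close> itself the point of integration.
\<close>

lemma nn_integral_tlength:
  assumes f [measurable]: "f \<in> borel_measurable (tborel T)"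
  shows "(\<integral>\<^sup>+p. f p \<partial>tlength T) =
    (\<integral>\<^sup>+v. (\<integral>\<^sup>+t. f (v, t) * indicator {0<..1} t \<partial>lborel) \<partial>count_space (V - {\<rho>}))"
proof -
  have sf: "sigma_finite_measure I01"
  proof (rule finite_measure.axioms(1), rule finite_measureI)
    show "emeasure I01 (space I01) \<noteq> \<infinity>"
      by (simp add: space_restrict_space emeasure_restrict_space)
  qed
  have m: "(\<lambda>(v, t). f (edge_point T v t)) \<in> borel_measurable (count_space (V - {\<rho>}) \<Otimes>\<^sub>M I01)"
    using measurable_compose[OF edge_map_measurable f] by (simp add: case_prod_beta')
  have "(\<integral>\<^sup>+p. f p \<partial>tlength T) =
      (\<integral>\<^sup>+q. (case q of (v, t) \<Rightarrow> f (edge_point T v t)) \<partial>(count_space (V - {\<rho>}) \<Otimes>\<^sub>M I01))"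
    unfolding tlength_def using edge_map_measurable
    by (subst nn_integral_distr) (auto simp: case_prod_beta')
  also have "\<dots> = (\<integral>\<^sup>+v. (\<integral>\<^sup>+t. f (edge_point T v t) \<partial>I01) \<partial>count_space (V - {\<rho>}))"
    by (subst sigma_finite_measure.nn_integral_fst[OF sf m, symmetric]) simp
  also have "\<dots> = (\<integral>\<^sup>+v. (\<integral>\<^sup>+t. f (v, t) * indicator {0<..1} t \<partial>lborel) \<partial>count_space (V - {\<rho>}))"
  proof (rule nn_integral_cong)
    fix v
    have "(\<integral>\<^sup>+t. f (edge_point T v t) \<partial>I01) = (\<integral>\<^sup>+t. f (edge_point T v t) * indicator {0..1} t \<partial>lborel)"
      by (subst nn_integral_restrict_space) auto
    also have "\<dots> = (\<integral>\<^sup>+t. f (v, t) * indicator {0<..1} t \<partial>lborel)"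
      by (rule nn_integral_cong_AE, rule AE_mp[OF AE_lborel_singleton[of 0]])
        (auto simp: edge_point_def indicator_def)
    finally show "(\<integral>\<^sup>+t. f (edge_point T v t) \<partial>I01) = (\<integral>\<^sup>+t. f (v, t) * indicator {0<..1} t \<partial>lborel)" .
  qed
  finally show ?thesis .
qed

lemma emeasure_tlength:
  assumes [measurable]: "A \<in> sets (tborel T)"
  shows "emeasure (tlength T) A =
    (\<integral>\<^sup>+v. (\<integral>\<^sup>+t. indicator A (v, t) * indicator {0<..1} t \<partial>lborel) \<partial>count_space (V - {\<rho>}))"
  using nn_integral_tlength[of "indicator A"] by (simp add: nn_integral_indicator sets_tlength)

text \<open>
  A height occurs at most once on each edge. Applied to one height, this discards the end points and
  the turning points of geodesics, where the sets under consideration overlap or fall short.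
\<close>

lemma AE_hgt_neq: "AE p in tlength T. hgt p \<noteq> c"
proof -
  let ?A = "{p \<in> X. hgt p = c}"
  have [measurable]: "?A \<in> sets (tborel T)"
    using measurable_sets[OF hgt_measurable, of "{c}"] by (simp add: vimage_def Int_def conj_commute)
  have "(\<integral>\<^sup>+t. indicator ?A (v, t) * indicator {0<..1} t \<partial>lborel) = 0" for v
  proof -
    have "AE t in lborel. indicator ?A (v, t) * indicator {0<..1} t = (0 :: ennreal)"
      using AE_lborel_singleton[of "c - real (depth v) + 1"]
      by eventually_elim (auto simp: hgt_def indicator_def)
    from nn_integral_cong_AE[OF this] show ?thesis by simp
  qed
  then have "emeasure (tlength T) ?A = 0" by (simp add: emeasure_tlength)
  then have "?A \<in> null_sets (tlength T)" by (auto simp: null_sets_def sets_tlength)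
  then show ?thesis by (rule AE_I') auto
qed

text \<open>
  The edge of \<open>v\<close> is cut out by conditions on the measurable functions \<open>hgt\<close> and \<open>meet (v, 1)\<close>. As
  there are countably many edges, sets and functions on the tree and on its square can therefore
  be treated one edge, or one pair of edges, at a time.
\<close>

lemma fst_measurable_tborel [measurable]: "fst \<in> tborel T \<rightarrow>\<^sub>M count_space V"
proof (subst measurable_count_space_eq_countable[OF countable_V], safe)
  fix p assume "p \<in> space (tborel T)"
  then show "fst p \<in> V" using points_vert by auto
next
  fix v assume v: "v \<in> V"
  have "fst p = v" if p: "p \<in> X" and m: "meet (v, 1) p = hgt p" "real (depth v) - 1 < hgt p" for p
  proof -
    have "hgt p \<le> hgt (v, 1)" using m meet_le[of "(v, 1)" p] by simp
    then have "depth v \<le> depth (fst p)" "depth (fst p) \<le> depth v"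
      using m(2) hgt_bounds[OF p] by (auto simp: hgt_vert)
    moreover have "p = point_at (v, 1) (hgt p)"
      using below_iff[OF p vert_point[OF v]] m(1) by (simp add: meet_commute)
    ultimately show ?thesis
      using ceiling_hgt[OF p] by (simp add: point_at_def) (metis ancestor_self fst_conv nat_int order_antisym)
  qed
  moreover have "meet (fst p, 1) p = hgt p \<and> real (depth (fst p)) - 1 < hgt p" if "p \<in> X" for p
    using hgt_bounds[OF that] points_vert[OF that] by (simp add: meet_def hgt_vert meet_depth_self)
  ultimately have "fst -` {v} \<inter> space (tborel T) =
      {p \<in> space (tborel T). meet (v, 1) p = hgt p \<and> real (depth v) - 1 < hgt p}"
    by auto
  also have "\<dots> \<in> sets (tborel T)"
    using vert_point[OF v] by measurable
  finally show "fst -` {v} \<inter> space (tborel T) \<in> sets (tborel T)" .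
qed

lemma meet_pair_measurable [measurable]:
  "(\<lambda>(x, y). meet x y) \<in> borel_measurable (tborel T \<Otimes>\<^sub>M tborel T)"
proof -
  have [measurable]: "(\<lambda>z. real (meet_depth (fst (fst z)) (fst (snd z))))
      \<in> borel_measurable (tborel T \<Otimes>\<^sub>M tborel T)"
  proof (rule measurable_compose_countable'[where I = V and g = "\<lambda>z. fst (fst z)"])
    fix v assume "v \<in> V"
    have [measurable]: "(\<lambda>w. real (meet_depth v w)) \<in> count_space V \<rightarrow>\<^sub>M borel" by simp
    show "(\<lambda>z. real (meet_depth v (fst (snd z)))) \<in> borel_measurable (tborel T \<Otimes>\<^sub>M tborel T)"
      by measurable
  qed (use countable_V in \<open>auto\<close>)
  show ?thesis unfolding meet_def by measurable
qed

lemma sigma_finite_tlength: "sigma_finite_measure (tlength T)"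
proof
  let ?A = "\<lambda>v. {p \<in> space (tborel T). fst p = v}"
  have A: "?A v \<in> sets (tborel T)" if "v \<in> V" for v
    using measurable_sets[OF fst_measurable_tborel, of "{v}"] that
    by (simp add: vimage_def Int_def conj_commute)
  have fin: "emeasure (tlength T) (?A v) \<noteq> \<infinity>" if v: "v \<in> V" for v
  proof -
    have "emeasure (tlength T) (?A v) \<le> (\<integral>\<^sup>+w. indicator {v} w \<partial>count_space (V - {\<rho>}))"
      unfolding emeasure_tlength[OF A[OF v]]
    proof (rule nn_integral_mono)
      fix w
      have "(\<integral>\<^sup>+t. indicator (?A v) (w, t) * indicator {0<..1} t \<partial>lborel)
          \<le> (\<integral>\<^sup>+t. indicator {v} w * indicator {0<..1::real} t \<partial>lborel)"
        by (rule nn_integral_mono) (auto simp: indicator_def)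
      also have "\<dots> = indicator {v} w" by (subst nn_integral_cmult) auto
      finally show "(\<integral>\<^sup>+t. indicator (?A v) (w, t) * indicator {0<..1} t \<partial>lborel) \<le> indicator {v} w" .
    qed
    also have "\<dots> = (\<Sum>w\<in>{v} \<inter> (V - {\<rho>}). indicator {v} w)"
      by (intro nn_integral_count_space') auto
    also have "\<dots> < \<infinity>" by (auto simp: of_nat_less_top)
    finally show ?thesis by simp
  qed
  show "\<exists>A. countable A \<and> A \<subseteq> sets (tlength T) \<and> \<Union>A = space (tlength T) \<and> (\<forall>a\<in>A. emeasure (tlength T) a \<noteq> \<infinity>)"
    using countable_V A fin points_vert
    by (intro exI[of _ "?A ` V"]) (auto simp: sets_tlength)
qed

end

section \<open>The weighted distance\<close>

lemma sum_indicator_unit_intervals: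
  "(\<Sum>n\<in>{1..N}. indicator {real n - 1<..real n} \<sigma>) = (indicator {0<..real N} \<sigma> :: ennreal)"
proof (induction N)
  case (Suc N)
  then show ?case by (simp add: indicator_def)
qed (simp add: indicator_def)

context bounded_tree
begin

lemma below_set_measurable:
  assumes "x \<in> X"
  shows "{p \<in> X. meet p x = hgt p} \<in> sets (tborel T)"
proof -
  have "{p \<in> space (tborel T). meet x p = hgt p} \<in> sets (tborel T)"
    using meet_measurable[OF assms] by measurable
  then show ?thesis by (simp add: meet_commute)
qed

text \<open>
  Height maps the way from the root to \<open>x\<close> isometrically to an interval: the edges on the way are
  those that end at an ancestor of the vertex \<open>v\<close> of \<open>x\<close>, and their heights tile the interval.
\<close>

lemma nn_integral_below:
  assumes x: "x \<in> X" and [measurable]: "G \<in> borel_measurable (borel :: real measure)"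
  shows "(\<integral>\<^sup>+p. G (hgt p) * indicator {p \<in> X. meet p x = hgt p} p \<partial>tlength T) =
    (\<integral>\<^sup>+\<sigma>. G \<sigma> * indicator {0<..hgt x} \<sigma> \<partial>lborel)"
proof -
  let ?S = "{p \<in> X. meet p x = hgt p}"
  define v where "v = fst x"
  define J where "J n = (\<integral>\<^sup>+\<sigma>. (G \<sigma> * indicator {0<..hgt x} \<sigma>) * indicator {real n - 1<..real n} \<sigma> \<partial>lborel)" for n :: nat
  let ?A = "ancestor v ` {1..depth v}"
  have v: "v \<in> V" using x points_vert v_def by auto
  have A: "w \<in> ?A \<longleftrightarrow> meet_depth w v = depth w" if w: "w \<in> V - {\<rho>}" for w
  proof
    assume "w \<in> ?A"
    then obtain n where n: "n \<in> {1..depth v}" "w = ancestor v n" by auto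
    then have "depth w = n" using depth_ancestor v by auto
    then have "ancestor w n = ancestor v n" using n(2) ancestor_self[of w] by simp
    then show "meet_depth w v = depth w"
      using ancestor_eq_iff[of w v n] meet_depth_le[of w v] \<open>depth w = n\<close> n v w by auto
  next
    assume m: "meet_depth w v = depth w"
    then have "depth w \<le> depth v" using meet_depth_le[of w v] v w by auto
    moreover from this have "ancestor v (depth w) = w"
      using ancestor_eq_iff[of w v "depth w"] m v w by auto
    moreover have "1 \<le> depth w" using depth_parent[of w] w by auto
    ultimately show "w \<in> ?A" by (intro image_eqI[of _ _ "depth w"]) auto
  qed
  have A_sub: "?A \<subseteq> V - {\<rho>}"
  proof
    fix w assume "w \<in> ?A"
    then obtain n where n: "1 \<le> n" "n \<le> depth v" "w = ancestor v n" by auto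
    then show "w \<in> V - {\<rho>}" using ancestor_vert[of v n] depth_ancestor[of v n] v by auto
  qed
  have inner: "(\<integral>\<^sup>+t. G (hgt (w, t)) * indicator ?S (w, t) * indicator {0<..1} t \<partial>lborel) =
      (if w \<in> ?A then J (depth w) else 0)" if w: "w \<in> V - {\<rho>}" for w
  proof -
    have S: "(w, t) \<in> ?S \<longleftrightarrow> w \<in> ?A \<and> real (depth w) - 1 + t \<le> hgt x" if t: "t \<in> {0<..1}" for t
    proof -
      have wX: "(w, t) \<in> X" using w t by (auto simp: points_def)
      have d: "meet_depth w v \<le> depth w" using meet_depth_le w v by auto
      have "meet_depth w v = depth w \<or> real (meet_depth w v) \<le> real (depth w) - 1"
        using d by linarith
      then show ?thesis
        unfolding A[OF w] using wX d t
        by (auto simp: meet_def hgt_def v_def[symmetric] min_def)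
    qed
    have pos: "1 \<le> depth w" using depth_parent[of w] w by auto
    show ?thesis
    proof (cases "w \<in> ?A")
      case True
      have "J (depth w) = (\<integral>\<^sup>+t. (G (real (depth w) - 1 + 1 * t) * indicator {0<..hgt x} (real (depth w) - 1 + 1 * t))
          * indicator {real (depth w) - 1<..real (depth w)} (real (depth w) - 1 + 1 * t) \<partial>lborel)"
        unfolding J_def by (subst nn_integral_real_affine[where c = 1 and t = "real (depth w) - 1"]) auto
      also have "\<dots> = (\<integral>\<^sup>+t. G (hgt (w, t)) * indicator ?S (w, t) * indicator {0<..1} t \<partial>lborel)"
        using S True pos by (intro nn_integral_cong) (auto simp: indicator_def hgt_def)
      finally show ?thesis using True by simp
    next
      case False
      have "(\<integral>\<^sup>+t. G (hgt (w, t)) * indicator ?S (w, t) * indicator {0<..1} t \<partial>lborel) = (\<integral>\<^sup>+(t::real). 0 \<partial>lborel)"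
        using S False by (intro nn_integral_cong) (auto simp: indicator_def)
      then show ?thesis using False by simp
    qed
  qed
  have inj: "inj_on (ancestor v) {1..depth v}"
    using depth_ancestor[OF v] by (intro inj_onI) (metis atLeastAtMost_iff)
  have [measurable]: "?S \<in> sets (tborel T)" by (rule below_set_measurable[OF x])
  have "(\<integral>\<^sup>+p. G (hgt p) * indicator ?S p \<partial>tlength T) =
      (\<integral>\<^sup>+w. (if w \<in> ?A then J (depth w) else 0) \<partial>count_space (V - {\<rho>}))"
    by (subst nn_integral_tlength, measurable, rule nn_integral_cong) (use inner in simp)
  also have "\<dots> = (\<Sum>w\<in>?A. if w \<in> ?A then J (depth w) else 0)"
    using A_sub by (intro nn_integral_count_space') auto
  also have "\<dots> = (\<Sum>n\<in>{1..depth v}. J n)"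
    by (subst sum.reindex[OF inj]) (auto intro!: sum.cong simp: depth_ancestor[OF v])
  also have "\<dots> = (\<integral>\<^sup>+\<sigma>. (\<Sum>n\<in>{1..depth v}. (G \<sigma> * indicator {0<..hgt x} \<sigma>) * indicator {real n - 1<..real n} \<sigma>) \<partial>lborel)"
    unfolding J_def by (subst nn_integral_sum) auto
  also have "\<dots> = (\<integral>\<^sup>+\<sigma>. G \<sigma> * indicator {0<..hgt x} \<sigma> \<partial>lborel)"
    unfolding sum_distrib_left[symmetric] sum_indicator_unit_intervals
    using hgt_bounds(2)[OF x] by (intro nn_integral_cong) (auto simp: indicator_def v_def)
  finally show ?thesis .
qed

end

locale weighted_tree = bounded_tree T K for T :: "'v rooted_graph" and K :: nat +
  fixes \<epsilon> \<beta> :: real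
  assumes eps_pos: "\<epsilon> > 0" and beta_gt: "\<beta> > ln (real K)"
begin

text \<open>The weighted length of the way from the root up to height \<open>s\<close>.\<close>

definition rlen :: "real \<Rightarrow> real" where
  "rlen s = (1 - exp (- \<epsilon> * s)) / \<epsilon>"

lemma rlen_0 [simp]: "rlen 0 = 0"
  by (simp add: rlen_def)

lemma rlen_le_iff [simp]: "rlen s \<le> rlen t \<longleftrightarrow> s \<le> t" and rlen_less_iff [simp]: "rlen s < rlen t \<longleftrightarrow> s < t"
  using eps_pos by (simp_all add: rlen_def divide_le_cancel divide_less_cancel)

lemma rlen_surj:
  assumes "0 \<le> c" "c \<le> rlen s"
  shows "\<exists>a. 0 \<le> a \<and> a \<le> s \<and> rlen a = c"
proof -
  let ?a = "- ln (1 - \<epsilon> * c) / \<epsilon>"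
  have "\<epsilon> * c \<le> \<epsilon> * rlen s" using assms eps_pos by simp
  also have "\<dots> = 1 - exp (- \<epsilon> * s)" using eps_pos by (simp add: rlen_def)
  also have "\<dots> < 1" by simp
  finally have lt: "\<epsilon> * c < 1" .
  have "rlen ?a = c" using eps_pos lt by (simp add: rlen_def)
  then show ?thesis using assms rlen_le_iff[of 0 ?a] rlen_le_iff[of ?a s] by (intro exI[of _ ?a]) simp
qed

lemma nn_integral_segment:
  assumes x: "x \<in> X" and a: "0 \<le> a" "a \<le> hgt x"
  shows "(\<integral>\<^sup>+p. ennreal (exp (- \<epsilon> * hgt p)) * indicator {p \<in> X. meet p x = hgt p \<and> a \<le> hgt p} p \<partial>tlength T)
    = ennreal (rlen (hgt x) - rlen a)"
proof -
  let ?G = "\<lambda>\<sigma>. ennreal (exp (- \<epsilon> * \<sigma>)) * indicator {a..hgt x} \<sigma>"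
  have "(\<integral>\<^sup>+p. ennreal (exp (- \<epsilon> * hgt p)) * indicator {p \<in> X. meet p x = hgt p \<and> a \<le> hgt p} p \<partial>tlength T)
      = (\<integral>\<^sup>+p. ?G (hgt p) * indicator {p \<in> X. meet p x = hgt p} p \<partial>tlength T)"
  proof (rule nn_integral_cong)
    fix p
    show "ennreal (exp (- \<epsilon> * hgt p)) * indicator {p \<in> X. meet p x = hgt p \<and> a \<le> hgt p} p =
        ?G (hgt p) * indicator {p \<in> X. meet p x = hgt p} p"
      using meet_le(2)[of p x] by (auto simp: indicator_def)
  qed
  also have "\<dots> = (\<integral>\<^sup>+\<sigma>. ?G \<sigma> * indicator {0<..hgt x} \<sigma> \<partial>lborel)"
    by (rule nn_integral_below[OF x]) measurable
  also have "\<dots> = (\<integral>\<^sup>+\<sigma>. ?G \<sigma> \<partial>lborel)"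
    by (rule nn_integral_cong_AE, rule AE_mp[OF AE_lborel_singleton[of 0]]) (use a in \<open>auto simp: indicator_def\<close>)
  also have "\<dots> = ennreal (rlen (hgt x) - rlen a)"
  proof (rule nn_integral_FTC_Icc)
    fix \<sigma> :: real
    show "(rlen has_real_derivative exp (- \<epsilon> * \<sigma>)) (at \<sigma>)"
      unfolding rlen_def using eps_pos by (auto intro!: derivative_eq_intros simp: field_simps)
  qed (use a in auto)
  finally show ?thesis .
qed

text \<open>
  The geodesic from \<open>x\<close> to \<open>y\<close> consists of the parts above the meet of the ways to \<open>x\<close> and to \<open>y\<close>,
  which share only a null set.
\<close>

lemma tdist_eq:
  assumes x: "x \<in> X" and y: "y \<in> X"
  shows "tdist T \<epsilon> x y = rlen (hgt x) + rlen (hgt y) - 2 * rlen (meet x y)"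
proof -
  let ?m = "meet x y"
  let ?S = "\<lambda>z. {p \<in> X. meet p z = hgt p \<and> ?m \<le> hgt p}"
  let ?e = "\<lambda>p. ennreal (exp (- \<epsilon> * hgt p))"
  have m: "0 \<le> ?m" "?m \<le> hgt x" "?m \<le> hgt y" using meet_nonneg meet_le x y by auto
  have S [measurable]: "?S z \<in> sets (tborel T)" if "z \<in> X" for z
  proof -
    have "{p \<in> space (tborel T). ?m \<le> hgt p} \<in> sets (tborel T)" by measurable
    then have "{p \<in> X. meet p z = hgt p} \<inter> {p \<in> space (tborel T). ?m \<le> hgt p} \<in> sets (tborel T)"
      by (rule sets.Int[OF below_set_measurable[OF that]])
    also have "{p \<in> X. meet p z = hgt p} \<inter> {p \<in> space (tborel T). ?m \<le> hgt p} = ?S z" by auto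
    finally show ?thesis .
  qed
  have geo: "geodesic T x y = ?S x \<union> ?S y" unfolding geodesic_eq[OF x y] by blast
  have disj: "hgt p = ?m" if "p \<in> ?S x" "p \<in> ?S y" for p
    using that meet_ultrametric[OF x _ y, of p] meet_commute[of x p] by auto
  have S_meas [measurable]: "?S x \<in> sets (tborel T)" "?S y \<in> sets (tborel T)" using S x y by auto
  have "(\<integral>\<^sup>+p. ?e p * indicator (geodesic T x y) p \<partial>tlength T) =
      (\<integral>\<^sup>+p. ?e p * indicator (?S x) p + ?e p * indicator (?S y) p \<partial>tlength T)"
    unfolding geo
    by (rule nn_integral_cong_AE, rule AE_mp[OF AE_hgt_neq[of ?m]])
      (use disj in \<open>auto simp: indicator_def\<close>)
  also have "\<dots> = ennreal (rlen (hgt x) - rlen ?m) + ennreal (rlen (hgt y) - rlen ?m)"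
    using nn_integral_segment[OF x m(1,2)] nn_integral_segment[OF y m(1,3)]
    by (subst nn_integral_add) auto
  also have "\<dots> = ennreal (rlen (hgt x) + rlen (hgt y) - 2 * rlen ?m)"
    using m by (subst ennreal_plus[symmetric]) auto
  finally have I: "(\<integral>\<^sup>+p. ?e p * indicator (geodesic T x y) p \<partial>tlength T) =
      ennreal (rlen (hgt x) + rlen (hgt y) - 2 * rlen ?m)" .
  have geo_meas [measurable]: "geodesic T x y \<in> sets (tborel T)" unfolding geo by measurable
  have "tdist T \<epsilon> x y = (LINT p|tlength T. indicator (geodesic T x y) p * exp (- \<epsilon> * hgt p))"
    unfolding tdist_def set_lebesgue_integral_def
    by (rule Bochner_Integration.integral_cong) (auto simp: height_eq)
  also have "\<dots> = enn2real (\<integral>\<^sup>+p. ennreal (indicator (geodesic T x y) p * exp (- \<epsilon> * hgt p)) \<partial>tlength T)"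
    by (rule integral_eq_nn_integral) auto
  also have "(\<integral>\<^sup>+p. ennreal (indicator (geodesic T x y) p * exp (- \<epsilon> * hgt p)) \<partial>tlength T) =
      (\<integral>\<^sup>+p. ?e p * indicator (geodesic T x y) p \<partial>tlength T)"
    by (rule nn_integral_cong) (auto simp: indicator_def)
  also have "enn2real \<dots> = rlen (hgt x) + rlen (hgt y) - 2 * rlen ?m"
  proof -
    have "0 \<le> rlen (hgt x) - rlen ?m" "0 \<le> rlen (hgt y) - rlen ?m" using m by auto
    then show ?thesis unfolding I by (intro enn2real_ennreal) linarith
  qed
  finally show ?thesis .
qed

lemma tball_measurable:
  assumes "x \<in> X"
  shows "tball T \<epsilon> x r \<in> sets (tborel T)"
proof -
  have [measurable]: "rlen \<in> borel_measurable borel" unfolding rlen_def by measurable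
  have "{y \<in> space (tborel T). rlen (hgt x) + rlen (hgt y) - 2 * rlen (meet x y) < r} \<in> sets (tborel T)"
    using meet_measurable[OF assms] by measurable
  also have "{y \<in> space (tborel T). rlen (hgt x) + rlen (hgt y) - 2 * rlen (meet x y) < r} = tball T \<epsilon> x r"
    using tdist_eq[OF assms] by (auto simp: tball_def)
  finally show ?thesis .
qed

section \<open>Measure of the part of a ball beyond a point\<close>

lemma beta_pos: "\<beta> > 0"
  using beta_gt K_pos ln_ge_zero[of "real K"] by linarith

lemma geometric_ratio: "0 \<le> real K * exp (- \<beta>)" "real K * exp (- \<beta>) < 1"
proof -
  have "real K = exp (ln (real K))" using K_pos by simp
  also have "\<dots> < exp \<beta>" using beta_gt by simp
  finally show "real K * exp (- \<beta>) < 1" by (simp add: exp_minus field_simps)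
qed simp

text \<open>
  Let \<open>S\<close> lie beyond \<open>p\<close> and meet each edge in length at most \<open>L\<close>. There are at most \<open>K ^ n\<close> edges
  \<open>n\<close> generations after the edge of \<open>p\<close>, on which the density of the measure is at most
  \<open>exp (- \<beta> * n)\<close> times its largest value on the edge of \<open>p\<close>. As \<open>\<beta> > ln K\<close>, the sum over
  the generations is a convergent geometric series.
\<close>

lemma weighted_measure_beyond:
  assumes p: "p \<in> X" and S [measurable]: "S \<in> sets (tborel T)" and L: "0 \<le> L"
    and beyond: "\<And>y. y \<in> S \<Longrightarrow> meet p y = hgt p"
    and edge: "\<And>w. w \<in> V - {\<rho>} \<Longrightarrow> (\<integral>\<^sup>+s. indicator S (w, s) * indicator {0<..1} s \<partial>lborel) \<le> ennreal L"
  shows "(\<integral>\<^sup>+y. ennreal (exp (- \<beta> * hgt y)) * indicator S y \<partial>tlength T)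
    \<le> ennreal (L * exp \<beta> / (1 - real K * exp (- \<beta>)) * exp (- \<beta> * hgt p))"
proof -
  define v where "v = fst p"
  define c where "c n = exp (- \<beta> * (real (depth v) + real n - 1)) * L" for n
  let ?q = "real K * exp (- \<beta>)"
  have v: "v \<in> V" using p points_vert v_def by auto
  have S_X: "S \<subseteq> X" using sets.sets_into_space[OF S] by simp
  have "(\<integral>\<^sup>+y. ennreal (exp (- \<beta> * hgt y)) * indicator S y \<partial>tlength T) =
     (\<integral>\<^sup>+w. (\<integral>\<^sup>+s. ennreal (exp (- \<beta> * hgt (w, s))) * indicator S (w, s) * indicator {0<..1} s \<partial>lborel) \<partial>count_space (V - {\<rho>}))"
    by (rule nn_integral_tlength) measurable
  also have "\<dots> \<le> (\<integral>\<^sup>+w. (\<Sum>n. ennreal (c n) * indicator (descendants v n) w) \<partial>count_space (V - {\<rho>}))"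
  proof (rule nn_integral_mono)
    fix w assume "w \<in> space (count_space (V - {\<rho>}))"
    then have w: "w \<in> V - {\<rho>}" by simp
    show "(\<integral>\<^sup>+s. ennreal (exp (- \<beta> * hgt (w, s))) * indicator S (w, s) * indicator {0<..1} s \<partial>lborel)
        \<le> (\<Sum>n. ennreal (c n) * indicator (descendants v n) w)"
    proof (cases "\<exists>s. (w, s) \<in> S")
      case True
      then obtain s where s: "(w, s) \<in> S" by blast
      then have y: "(w, s) \<in> X" using S_X by auto
      have b: "hgt p \<le> hgt (w, s)" "p = point_at (w, s) (hgt p)"
        using below_iff[OF p y] beyond[OF s] by auto
      then have "depth v \<le> depth w"
        using ceiling_le_depth[OF y, of "hgt p"] ceiling_hgt[OF p] by (simp add: v_def)
      moreover have "ancestor w (depth v) = v"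
        using arg_cong[OF b(2), of fst] ceiling_hgt[OF p] by (simp add: point_at_def v_def)
      ultimately obtain n where n: "depth w = depth v + n" "w \<in> descendants v n"
        using w by (auto simp: descendants_def nat_le_iff_add)
      have [measurable]: "(\<lambda>s. indicator S (w, s) * indicator {0<..1} s :: ennreal) \<in> borel_measurable lborel"
      proof -
        have e: "(\<lambda>s. indicator S (edge_point T w s) :: ennreal) \<in> borel_measurable I01"
          using w by (intro measurable_compose[OF edge_point_measurable] borel_measurable_indicator S) auto
        have "(\<lambda>s. indicator S (edge_point T w s) * indicator {0..1} s :: ennreal) \<in> borel_measurable lborel"
          using e by (subst (asm) borel_measurable_restrict_space_iff_ennreal) auto
        then have "(\<lambda>s. indicator S (edge_point T w s) * indicator {0..1} s * indicator {0<..} s :: ennreal) \<in> borel_measurable lborel"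
          by measurable
        also have "(\<lambda>s. indicator S (edge_point T w s) * indicator {0..1} s * indicator {0<..} s :: ennreal)
            = (\<lambda>s. indicator S (w, s) * indicator {0<..1} s)"
          by (auto simp: indicator_def edge_point_def fun_eq_iff)
        finally show ?thesis .
      qed
      have "(\<integral>\<^sup>+s. ennreal (exp (- \<beta> * hgt (w, s))) * indicator S (w, s) * indicator {0<..1} s \<partial>lborel)
          \<le> (\<integral>\<^sup>+s. ennreal (exp (- \<beta> * (real (depth w) - 1))) * (indicator S (w, s) * indicator {0<..1} s) \<partial>lborel)"
        using beta_pos by (intro nn_integral_mono) (auto simp: indicator_def hgt_def intro!: ennreal_leI)
      also have "\<dots> = ennreal (exp (- \<beta> * (real (depth w) - 1))) * (\<integral>\<^sup>+s. indicator S (w, s) * indicator {0<..1} s \<partial>lborel)"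
        by (rule nn_integral_cmult) measurable
      also have "\<dots> \<le> ennreal (exp (- \<beta> * (real (depth w) - 1))) * ennreal L"
        by (intro mult_left_mono edge[OF w]) auto
      also have "\<dots> = ennreal (c n) * indicator (descendants v n) w"
        using n L by (simp add: c_def ennreal_mult)
      also have "\<dots> \<le> (\<Sum>n. ennreal (c n) * indicator (descendants v n) w)"
      proof -
        let ?f = "\<lambda>n. ennreal (c n) * indicator (descendants v n) w :: ennreal"
        have "?f n = sum ?f {n}" by (subst sum.insert) auto
        also have "\<dots> \<le> suminf ?f" by (rule sum_le_suminf) auto
        finally show ?thesis .
      qed
      finally show ?thesis .
    qed simp
  qed
  also have "\<dots> = (\<Sum>n. \<integral>\<^sup>+w. ennreal (c n) * indicator (descendants v n) w \<partial>count_space (V - {\<rho>}))"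
    by (rule nn_integral_suminf) simp
  also have "\<dots> \<le> (\<Sum>n. ennreal (c n * real K ^ n))"
  proof (rule suminf_le)
    fix n
    have "(\<integral>\<^sup>+w. ennreal (c n) * indicator (descendants v n) w \<partial>count_space (V - {\<rho>}))
        = (\<Sum>w\<in>descendants v n \<inter> (V - {\<rho>}). ennreal (c n) * indicator (descendants v n) w)"
      using descendants_card[OF v, of n] by (intro nn_integral_count_space') auto
    also have "\<dots> = of_nat (card (descendants v n \<inter> (V - {\<rho>}))) * ennreal (c n)"
      by simp
    also have "\<dots> \<le> of_nat (K ^ n) * ennreal (c n)"
      using descendants_card[OF v, of n] card_mono[of "descendants v n" "descendants v n \<inter> (V - {\<rho>})"]
      by (intro mult_right_mono) (auto simp del: of_nat_power)
    also have "\<dots> = ennreal (c n * real K ^ n)"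
      using L by (simp add: c_def ennreal_mult ennreal_of_nat_eq_real_of_nat[symmetric] ennreal_power[symmetric] mult.commute)
    finally show "(\<integral>\<^sup>+w. ennreal (c n) * indicator (descendants v n) w \<partial>count_space (V - {\<rho>})) \<le> ennreal (c n * real K ^ n)" .
  qed auto
  also have "\<dots> = ennreal (exp (- \<beta> * (real (depth v) - 1)) * L * (1 / (1 - ?q)))"
  proof (rule suminf_ennreal_eq)
    have "c n * real K ^ n = exp (- \<beta> * (real (depth v) - 1)) * L * ?q ^ n" for n
    proof -
      have "- \<beta> * (real (depth v) + real n - 1) = - \<beta> * (real (depth v) - 1) + real n * (- \<beta>)"
        by (simp add: algebra_simps)
      then have "exp (- \<beta> * (real (depth v) + real n - 1)) = exp (- \<beta> * (real (depth v) - 1)) * exp (- \<beta>) ^ n"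
        by (simp only: exp_add exp_of_nat_mult)
      then show ?thesis by (simp add: c_def power_mult_distrib)
    qed
    then show "(\<lambda>n. c n * real K ^ n) sums (exp (- \<beta> * (real (depth v) - 1)) * L * (1 / (1 - ?q)))"
      using geometric_sums[of ?q] geometric_ratio by (simp only:) (intro sums_mult, simp)
    show "0 \<le> c n * real K ^ n" for n using L by (simp add: c_def)
  qed
  also have "\<dots> \<le> ennreal (L * exp \<beta> / (1 - ?q) * exp (- \<beta> * hgt p))"
  proof (rule ennreal_leI)
    have "exp (- \<beta> * (real (depth v) - 1)) \<le> exp \<beta> * exp (- \<beta> * hgt p)"
      unfolding exp_add[symmetric] using hgt_bounds(2)[OF p] beta_pos
      by (simp add: v_def algebra_simps)
    then have "exp (- \<beta> * (real (depth v) - 1)) * (L / (1 - ?q)) \<le> exp \<beta> * exp (- \<beta> * hgt p) * (L / (1 - ?q))"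
      using L geometric_ratio by (intro mult_right_mono) auto
    then show "exp (- \<beta> * (real (depth v) - 1)) * L * (1 / (1 - ?q)) \<le> L * exp \<beta> / (1 - ?q) * exp (- \<beta> * hgt p)"
      by (simp add: mult_ac)
  qed
  finally show ?thesis .
qed

end

context weighted_tree
begin

text \<open>
  Up to the factor \<open>exp (\<epsilon> * hgt p)\<close>, a bound for the length on one edge of the points beyond \<open>p\<close>
  at distance at most \<open>2 * r\<close> from \<open>p\<close>.
\<close>

definition edge_bound :: "real \<Rightarrow> real" where
  "edge_bound r = 2 * r * \<epsilon> / (1 - exp (- \<epsilon>))"

lemma edge_bound_nonneg: "0 \<le> r \<Longrightarrow> 0 \<le> edge_bound r"
  using eps_pos by (simp add: edge_bound_def)

text \<open>
  Climbing from height \<open>a\<close> by the unweighted amount \<open>s \<le> 1\<close> costs, by convexity of the exponential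
  function, at least \<open>s\<close> times the cost of climbing by \<open>1\<close>. The last assumption says that \<open>2 * r\<close> does
  not pay for a full unit of height.
\<close>

lemma height_gain:
  assumes "a \<le> b" "rlen b - rlen a \<le> 2 * r" "edge_bound r * exp (\<epsilon> * a) < 1"
  shows "b - a \<le> edge_bound r * exp (\<epsilon> * a)"
proof -
  let ?L = "edge_bound r * exp (\<epsilon> * a)"
  have q: "0 < 1 - exp (- \<epsilon>)" using eps_pos by simp
  have "rlen b - rlen a = exp (- \<epsilon> * a) * (1 - exp (- \<epsilon> * (b - a))) / \<epsilon>"
    using eps_pos by (simp add: rlen_def field_simps flip: exp_add)
  then have "exp (- \<epsilon> * a) * (1 - exp (- \<epsilon> * (b - a))) \<le> 2 * r * \<epsilon>"
    using assms(2) eps_pos by (simp add: pos_divide_le_eq)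
  then have "exp (\<epsilon> * a) * (exp (- \<epsilon> * a) * (1 - exp (- \<epsilon> * (b - a)))) \<le> exp (\<epsilon> * a) * (2 * r * \<epsilon>)"
    by (intro mult_left_mono) auto
  moreover have "exp (\<epsilon> * a) * exp (- \<epsilon> * a) = 1" by (simp add: exp_minus)
  ultimately have "1 - exp (- \<epsilon> * (b - a)) \<le> exp (\<epsilon> * a) * (2 * r * \<epsilon>)"
    by (simp only: mult.assoc[symmetric] mult_1)
  also have "\<dots> = ?L * (1 - exp (- \<epsilon>))" using q by (simp add: edge_bound_def)
  finally have gain: "1 - exp (- \<epsilon> * (b - a)) \<le> ?L * (1 - exp (- \<epsilon>))" .
  also have "\<dots> < 1 * (1 - exp (- \<epsilon>))" using assms(3) q by (intro mult_strict_right_mono)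
  finally have "- \<epsilon> < - \<epsilon> * (b - a)" by simp
  then have "\<epsilon> * (b - a) < \<epsilon> * 1" by linarith
  then have "b - a < 1" using eps_pos by (simp only: mult_less_cancel_left_pos)
  then have s: "0 \<le> b - a" "b - a \<le> 1" using assms(1) by simp_all
  have "exp ((1 - (b - a)) *\<^sub>R 0 + (b - a) *\<^sub>R (- \<epsilon>)) \<le> (1 - (b - a)) * exp 0 + (b - a) * exp (- \<epsilon>)"
    using s by (intro convex_onD[OF exp_convex]) auto
  then have "(b - a) * (1 - exp (- \<epsilon>)) \<le> 1 - exp (- \<epsilon> * (b - a))"
    by (simp add: algebra_simps)
  also note gain
  finally show ?thesis using q by simp
qed

text \<open>
  By \<open>height_gain\<close>, the part of \<open>S\<close> on one edge is no longer than \<open>edge_bound r * exp (\<epsilon> * hgt p)\<close>: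
  if this is less than \<open>1\<close> it bounds the range of heights in \<open>S\<close>, and otherwise it is at least
  the length of the edge.
\<close>

lemma ball_beyond_measure:
  assumes p: "p \<in> X" and S: "S \<in> sets (tborel T)" and r: "r > 0"
    and beyond: "\<And>y. y \<in> S \<Longrightarrow> meet p y = hgt p"
    and close: "\<And>y. y \<in> S \<Longrightarrow> rlen (hgt y) - rlen (hgt p) \<le> 2 * r"
  shows "(\<integral>\<^sup>+y. ennreal (exp (- \<beta> * hgt y)) * indicator S y \<partial>tlength T)
    \<le> ennreal (edge_bound r * exp (\<epsilon> * hgt p) * exp \<beta> / (1 - real K * exp (- \<beta>)) * exp (- \<beta> * hgt p))"
proof (rule weighted_measure_beyond[OF p S _ beyond])
  let ?L = "edge_bound r * exp (\<epsilon> * hgt p)"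
  show L: "0 \<le> ?L" using edge_bound_nonneg r by simp
  fix w
  show "(\<integral>\<^sup>+s. indicator S (w, s) * indicator {0<..1} s \<partial>lborel) \<le> ennreal ?L"
  proof (cases "?L < 1")
    case True
    let ?c = "hgt p - real (depth w) + 1"
    have "s \<in> {?c..?c + ?L}" if "(w, s) \<in> S" for s
    proof -
      have "hgt p \<le> hgt (w, s)" using beyond[OF that] meet_le(2)[of p "(w, s)"] by simp
      then show ?thesis
        using height_gain[OF _ close[OF that] True] by (simp add: hgt_def)
    qed
    then have "(\<integral>\<^sup>+s. indicator S (w, s) * indicator {0<..1} s \<partial>lborel) \<le> (\<integral>\<^sup>+s. indicator {?c..?c + ?L} s \<partial>lborel)"
      by (intro nn_integral_mono) (auto simp: indicator_def)
    also have "\<dots> = ennreal ?L" using L by simp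
    finally show ?thesis .
  next
    case False
    have "(\<integral>\<^sup>+s. indicator S (w, s) * indicator {0<..1} s \<partial>lborel) \<le> (\<integral>\<^sup>+s. indicator {0<..1::real} s \<partial>lborel)"
      by (intro nn_integral_mono) (auto simp: indicator_def)
    also have "\<dots> \<le> ennreal ?L" using False by (simp add: ennreal_1[symmetric] del: ennreal_1)
    finally show ?thesis .
  qed
qed

lemma sets_tmu: "A \<in> sets (tborel T) \<Longrightarrow> A \<in> sets (tmu T \<beta>)"
  by (simp add: tmu_def sets_tlength)

lemma nn_integral_tmu:
  assumes [measurable]: "f \<in> borel_measurable (tborel T)"
  shows "(\<integral>\<^sup>+y. f y \<partial>tmu T \<beta>) = (\<integral>\<^sup>+y. ennreal (exp (- \<beta> * hgt y)) * f y \<partial>tlength T)"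
  unfolding tmu_def nn_integral_completion
  by (subst nn_integral_density) (auto intro!: nn_integral_cong simp: height_eq)

lemma nn_integral_tmu_mono:
  assumes "\<And>y. y \<in> X \<Longrightarrow> f y \<le> g y"
  shows "(\<integral>\<^sup>+y. f y \<partial>tmu T \<beta>) \<le> (\<integral>\<^sup>+y. g y \<partial>tmu T \<beta>)"
  using assms by (intro nn_integral_mono) (auto simp: tmu_def)

lemma finite_measure_tmu: "finite_measure (tmu T \<beta>)"
proof (rule finite_measureI)
  have sp: "space (tmu T \<beta>) = X" by (simp add: tmu_def)
  have X [measurable]: "X \<in> sets (tborel T)" using sets.top[of "tborel T"] by simp
  have "emeasure (tmu T \<beta>) X = (\<integral>\<^sup>+y. indicator X y \<partial>tmu T \<beta>)"
    by (simp add: sets_tmu X)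
  also have "\<dots> = (\<integral>\<^sup>+y. ennreal (exp (- \<beta> * hgt y)) * indicator X y \<partial>tlength T)"
    by (rule nn_integral_tmu) measurable
  also have "\<dots> \<le> ennreal (1 * exp \<beta> / (1 - real K * exp (- \<beta>)) * exp (- \<beta> * hgt (\<rho>, 1)))"
  proof (rule weighted_measure_beyond[OF root_point X])
    show "meet (\<rho>, 1) y = hgt (\<rho>, 1)" if "y \<in> X" for y
      using meet_nonneg[OF root_point that] meet_le(1)[of "(\<rho>, 1)" y] hgt_root by simp
    fix w
    have "(\<integral>\<^sup>+s. indicator X (w, s) * indicator {0<..1} s \<partial>lborel) \<le> (\<integral>\<^sup>+s. indicator {0<..1::real} s \<partial>lborel)"
      by (intro nn_integral_mono) (auto simp: indicator_def)
    then show "(\<integral>\<^sup>+s. indicator X (w, s) * indicator {0<..1} s \<partial>lborel) \<le> ennreal 1" by simp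
  qed simp
  also have "\<dots> < \<infinity>" by simp
  finally show "emeasure (tmu T \<beta>) (space (tmu T \<beta>)) \<noteq> \<infinity>" by (simp add: sp)
qed

end

section \<open>The Poincare inequality\<close>

text \<open>
  By the triangle inequality, since \<open>\<bar>c - mean_value M B u\<bar>\<close> times the measure of \<open>B\<close> is at most
  the integral of \<open>\<bar>u z - c\<bar>\<close> over \<open>B\<close>.
\<close>

lemma (in finite_measure) mean_value_deviation:
  assumes B: "B \<in> sets M" and u: "integrable M u"
  shows "(\<integral>\<^sup>+z\<in>B. ennreal \<bar>u z - mean_value M B u\<bar> \<partial>M) \<le> 2 * (\<integral>\<^sup>+z\<in>B. ennreal \<bar>u z - c\<bar> \<partial>M)"
proof -
  let ?m = "mean_value M B u" and ?b = "measure M B"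
  have int: "set_integrable M B (\<lambda>z. u z - k)" for k
    unfolding set_integrable_def
    by (rule integrable_mult_indicator[OF B]) (intro Bochner_Integration.integrable_diff u integrable_const)
  have int_u: "set_integrable M B u" using int[of 0] by simp
  let ?I = "LINT z:B|M. \<bar>u z - c\<bar>"
  have int_abs: "set_integrable M B (\<lambda>z. \<bar>u z - c\<bar>)" using set_integrable_abs[OF int] .
  have I: "(\<integral>\<^sup>+z\<in>B. ennreal \<bar>u z - c\<bar> \<partial>M) = ennreal ?I"
    using int_abs unfolding set_integrable_def set_lebesgue_integral_def
    by (subst nn_integral_eq_integral[symmetric]) (auto simp: indicator_def intro!: nn_integral_cong)
  have "\<bar>c - ?m\<bar> * ?b \<le> ?I"
  proof (cases "?b = 0")
    case True
    have "0 \<le> ?I" unfolding set_lebesgue_integral_def by (intro integral_nonneg_AE) auto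
    then show ?thesis using True by simp
  next
    case False
    have const: "set_integrable M B (\<lambda>_. c)" "(LINT z:B|M. c) = c * ?b"
      using B integrable_real_indicator[OF B]
      by (auto simp: set_integrable_def set_lebesgue_integral_def emeasure_eq_measure)
    have "(LINT z:B|M. u z - c) = (LINT z:B|M. u z) - c * ?b"
      using set_integral_diff(2)[OF int_u const(1)] const(2) by simp
    then have "\<bar>c - ?m\<bar> * ?b = \<bar>LINT z:B|M. u z - c\<bar>"
      using False by (simp add: mean_value_def divide_simps abs_minus_commute flip: abs_mult)
    also have "\<dots> \<le> ?I" using set_integral_norm_bound[OF int[of c]] by simp
    finally show ?thesis .
  qed
  moreover have "(\<integral>\<^sup>+z\<in>B. ennreal \<bar>u z - ?m\<bar> \<partial>M) \<le> ennreal ?I + ennreal (\<bar>c - ?m\<bar> * ?b)"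
  proof -
    have "(\<integral>\<^sup>+z\<in>B. ennreal \<bar>u z - ?m\<bar> \<partial>M)
        \<le> (\<integral>\<^sup>+z. ennreal \<bar>u z - c\<bar> * indicator B z + ennreal \<bar>c - ?m\<bar> * indicator B z \<partial>M)"
      by (intro nn_integral_mono) (auto simp: indicator_def simp flip: ennreal_plus intro!: ennreal_leI)
    also have "\<dots> = (\<integral>\<^sup>+z\<in>B. ennreal \<bar>u z - c\<bar> \<partial>M) + (\<integral>\<^sup>+z. ennreal \<bar>c - ?m\<bar> * indicator B z \<partial>M)"
      using B u by (intro nn_integral_add) auto
    also have "(\<integral>\<^sup>+z. ennreal \<bar>c - ?m\<bar> * indicator B z \<partial>M) = ennreal (\<bar>c - ?m\<bar> * ?b)"
      using B by (simp add: nn_integral_cmult_indicator emeasure_eq_measure ennreal_mult)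
    finally show ?thesis by (simp add: I)
  qed
  ultimately have "(\<integral>\<^sup>+z\<in>B. ennreal \<bar>u z - ?m\<bar> \<partial>M) \<le> ennreal ?I + ennreal ?I"
    by (meson add_left_mono ennreal_leI order_trans)
  then show ?thesis by (simp add: I mult_2)
qed

context weighted_tree
begin

text \<open>
  The point \<open>z\<close> on the way to \<open>x\<close> is the root if the root is within distance \<open>r\<close> of \<open>x\<close>, and is at
  distance exactly \<open>r\<close> from \<open>x\<close> otherwise. In the second case \<open>z\<close> is not in the ball, but
  everything beyond \<open>z\<close> on the way to a point of the ball is.
\<close>

lemma ball_top:
  assumes x: "x \<in> X" and r: "r > 0"
  obtains z where "z \<in> X"
    "\<And>y. y \<in> tball T \<epsilon> x r \<Longrightarrow> meet z y = hgt z"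
    "\<And>y p. y \<in> tball T \<epsilon> x r \<Longrightarrow> p \<in> X \<Longrightarrow> meet p y = hgt p \<Longrightarrow> hgt z < hgt p \<Longrightarrow>
       p \<in> tball T \<epsilon> x r \<and> rlen (hgt y) - rlen (hgt p) \<le> 2 * r"
proof -
  have h: "0 \<le> rlen (hgt x)" using hgt_bounds(3)[OF x] rlen_le_iff[of 0 "hgt x"] by simp
  have "\<exists>a. 0 \<le> a \<and> a \<le> hgt x \<and> rlen (hgt x) - rlen a \<le> r \<and> (a = 0 \<or> rlen (hgt x) - rlen a = r)"
  proof (cases "rlen (hgt x) \<le> r")
    case True
    then show ?thesis using hgt_bounds(3)[OF x] by (intro exI[of _ 0]) auto
  next
    case False
    then obtain a where "0 \<le> a" "a \<le> hgt x" "rlen a = rlen (hgt x) - r"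
      using rlen_surj[of "rlen (hgt x) - r" "hgt x"] r by auto
    then show ?thesis by (intro exI[of _ a]) auto
  qed
  then obtain a where a: "0 \<le> a" "a \<le> hgt x" "rlen (hgt x) - rlen a \<le> r"
    and a_cases: "a = 0 \<or> rlen (hgt x) - rlen a = r" by blast
  define z where "z = point_at x a"
  have z: "z \<in> X" "hgt z = a" using point_at_point[OF x a(1,2)] hgt_point_at[OF x a(1,2)] z_def by auto
  have ball: "y \<in> X" "rlen (hgt x) + rlen (hgt y) - 2 * rlen (meet x y) < r"
    "rlen (meet x y) \<le> rlen (hgt x)" "rlen (meet x y) \<le> rlen (hgt y)" if "y \<in> tball T \<epsilon> x r" for y
    using that tdist_eq[OF x, of y] meet_le[of x y] by (auto simp: tball_def)
  have above: "a \<le> meet x y" if y: "y \<in> tball T \<epsilon> x r" for y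
    using a_cases
  proof
    assume "a = 0"
    then show ?thesis using meet_nonneg[OF x ball(1)[OF y]] by simp
  next
    assume "rlen (hgt x) - rlen a = r"
    then have "rlen a < rlen (meet x y)" using ball[OF y] by linarith
    then show ?thesis by simp
  qed
  show thesis
  proof (rule that[OF z(1)])
    fix y assume y: "y \<in> tball T \<epsilon> x r"
    have yX: "y \<in> X" using ball(1)[OF y] .
    have "meet z y = meet (point_at x a) (point_at y (hgt y))" using yX by (simp add: z_def)
    also have "\<dots> = min (min a (hgt y)) (meet x y)"
      using a x yX hgt_bounds(3)[OF yX] by (intro meet_point_at) auto
    also have "\<dots> = a" using above[OF y] meet_le(2)[of x y] by simp
    finally show "meet z y = hgt z" using z by simp
  next
    fix y p assume y: "y \<in> tball T \<epsilon> x r" and p: "p \<in> X" "meet p y = hgt p" "hgt z < hgt p"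
    have yX: "y \<in> X" using ball(1)[OF y] .
    have py: "hgt p \<le> hgt y" "p = point_at y (hgt p)" using below_iff[OF p(1) yX] p(2) by auto
    have "meet x p = meet (point_at x (hgt x)) (point_at y (hgt p))" using py x by simp
    also have "\<dots> = min (min (hgt x) (hgt p)) (meet x y)"
      using py x yX hgt_bounds(3)[OF x] hgt_bounds(3)[OF p(1)] by (intro meet_point_at) auto
    also have "\<dots> = min (hgt p) (meet x y)" using meet_le(1)[of x y] by auto
    finally have m: "meet x p = min (hgt p) (meet x y)" .
    have ap: "rlen a < rlen (hgt p)" using p z by simp
    have "tdist T \<epsilon> x p < r"
    proof (cases "hgt p \<le> meet x y")
      case True
      then have "tdist T \<epsilon> x p = rlen (hgt x) - rlen (hgt p)" using m tdist_eq[OF x p(1)] by simp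
      then show ?thesis using ap a(3) by linarith
    next
      case False
      then have "tdist T \<epsilon> x p = rlen (hgt x) + rlen (hgt p) - 2 * rlen (meet x y)"
        using m tdist_eq[OF x p(1)] by simp
      moreover have "rlen (hgt p) \<le> rlen (hgt y)" using py by simp
      ultimately show ?thesis using ball(2)[OF y] by linarith
    qed
    moreover have "rlen (hgt y) - rlen (hgt p) \<le> 2 * r"
      using ball[OF y] a(3) ap by linarith
    ultimately show "p \<in> tball T \<epsilon> x r \<and> rlen (hgt y) - rlen (hgt p) \<le> 2 * r"
      using p by (simp add: tball_def)
  qed
qed

text \<open>
  The factor 4 has two sources: the ball lies within distance \<open>2 * r\<close> of its top, and the mean
  value replaces \<open>u z\<close> at the cost of a factor two.
\<close>

definition poincare_const :: real where
  "poincare_const = 4 * \<epsilon> * exp \<beta> / ((1 - exp (- \<epsilon>)) * (1 - real K * exp (- \<beta>)))"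

lemma poincare_const_pos: "poincare_const > 0"
  using eps_pos geometric_ratio by (simp add: poincare_const_def)

text \<open>
  For \<open>y\<close> in the ball, \<open>\<bar>u y - u z\<bar>\<close> is at most the integral of \<open>g\<close> along the way from the top \<open>z\<close>
  to \<open>y\<close>. Integrating over \<open>y\<close> and exchanging the integrals, each point \<open>p\<close> of the ball is counted
  with the measure of the part of the ball beyond \<open>p\<close>; the weight \<open>exp (- \<epsilon> * hgt p)\<close> of the arc
  length cancels the factor \<open>exp (\<epsilon> * hgt p)\<close> in the bound for that measure.
\<close>

lemma deviation_from_top:
  assumes x: "x \<in> X" and r: "r > 0" and ug: "upper_gradient T \<epsilon> u g"
  shows "\<exists>c. (\<integral>\<^sup>+y\<in>tball T \<epsilon> x r. ennreal \<bar>u y - c\<bar> \<partial>tmu T \<beta>)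
    \<le> ennreal (poincare_const / 2 * r) * (\<integral>\<^sup>+y\<in>tball T \<epsilon> x r. g y \<partial>tmu T \<beta>)"
proof -
  let ?B = "tball T \<epsilon> x r"
  obtain z where z: "z \<in> X"
    and top: "\<And>y. y \<in> ?B \<Longrightarrow> meet z y = hgt z"
    and way: "\<And>y p. y \<in> ?B \<Longrightarrow> p \<in> X \<Longrightarrow> meet p y = hgt p \<Longrightarrow> hgt z < hgt p \<Longrightarrow>
       p \<in> ?B \<and> rlen (hgt y) - rlen (hgt p) \<le> 2 * r"
    using ball_top[OF x r] by metis
  have B [measurable]: "?B \<in> sets (tborel T)" by (rule tball_measurable[OF x])
  have B_X: "?B \<subseteq> X" by (auto simp: tball_def)
  have g [measurable]: "g \<in> borel_measurable (tborel T)" using ug by (simp add: upper_gradient_def)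
  let ?w = "\<lambda>p. g p * ennreal (exp (- \<epsilon> * hgt p))"
  let ?D = "{(p, y). p \<in> ?B \<and> y \<in> ?B \<and> hgt z < hgt p \<and> meet p y = hgt p}"
  interpret sf: sigma_finite_measure "tlength T" by (rule sigma_finite_tlength)
  interpret pair_sigma_finite "tlength T" "tlength T" ..
  have D [measurable]: "?D \<in> sets (tborel T \<Otimes>\<^sub>M tborel T)"
  proof -
    have "{q \<in> space (tborel T \<Otimes>\<^sub>M tborel T). fst q \<in> ?B \<and> snd q \<in> ?B \<and> hgt z < hgt (fst q) \<and>
        (case q of (p, y) \<Rightarrow> meet p y) = hgt (fst q)} \<in> sets (tborel T \<Otimes>\<^sub>M tborel T)"
      by measurable
    also have "{q \<in> space (tborel T \<Otimes>\<^sub>M tborel T). fst q \<in> ?B \<and> snd q \<in> ?B \<and> hgt z < hgt (fst q) \<and>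
        (case q of (p, y) \<Rightarrow> meet p y) = hgt (fst q)} = ?D"
      using B_X by (auto simp: space_pair_measure)
    finally show ?thesis .
  qed
  have D_slice: "{y. (p, y) \<in> ?D} \<in> sets (tborel T)" for p
    using sets_Pair1[OF D, of p] by (simp add: vimage_def)
  have pointwise: "ennreal \<bar>u y - u z\<bar> \<le> (\<integral>\<^sup>+p. ?w p * indicator ?D (p, y) \<partial>tlength T)" if y: "y \<in> ?B" for y
  proof -
    have yX: "y \<in> X" using y B_X by auto
    have "ennreal \<bar>u y - u z\<bar> = ennreal \<bar>u z - u y\<bar>" by (simp add: abs_minus_commute)
    also have "\<dots> \<le> (\<integral>\<^sup>+p\<in>geodesic T z y. (g p * ennreal (exp (- \<epsilon> * height T p))) \<partial>tlength T)"
      using ug z yX by (simp add: upper_gradient_def)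
    also have "\<dots> \<le> (\<integral>\<^sup>+p. ?w p * indicator ?D (p, y) \<partial>tlength T)"
    proof (rule nn_integral_mono_AE, rule AE_mp[OF AE_hgt_neq[of "hgt z"]], rule AE_I2, rule impI)
      fix p assume p: "p \<in> space (tlength T)" "hgt p \<noteq> hgt z"
      have "(p, y) \<in> ?D" if "p \<in> geodesic T z y"
      proof -
        have "hgt z < hgt p" "meet p z = hgt p \<or> meet p y = hgt p"
          using that p(2) top[OF y] unfolding geodesic_eq[OF z yX] by auto
        then show ?thesis using way[OF y, of p] p(1) y meet_le(2)[of p z] by auto
      qed
      then show "g p * ennreal (exp (- \<epsilon> * height T p)) * indicator (geodesic T z y) p \<le> ?w p * indicator ?D (p, y)"
        using p(1) by (auto simp: indicator_def height_eq)
    qed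
    finally show ?thesis .
  qed
  have inner: "(\<integral>\<^sup>+y. ennreal (exp (- \<beta> * hgt y)) * (?w p * indicator ?D (p, y)) \<partial>tlength T)
      \<le> ennreal (poincare_const / 2 * r) * (ennreal (exp (- \<beta> * hgt p)) * (g p * indicator ?B p))"
    if p: "p \<in> X" for p
  proof (cases "p \<in> ?B")
    case True
    let ?S = "{y. (p, y) \<in> ?D}"
    have [measurable]: "?S \<in> sets (tborel T)" by (rule D_slice)
    have "(\<integral>\<^sup>+y. ennreal (exp (- \<beta> * hgt y)) * (?w p * indicator ?D (p, y)) \<partial>tlength T)
        = (\<integral>\<^sup>+y. ?w p * (ennreal (exp (- \<beta> * hgt y)) * indicator ?S y) \<partial>tlength T)"
      by (intro nn_integral_cong) (auto simp: indicator_def mult_ac)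
    also have "\<dots> = ?w p * (\<integral>\<^sup>+y. ennreal (exp (- \<beta> * hgt y)) * indicator ?S y \<partial>tlength T)"
      by (rule nn_integral_cmult) measurable
    also have "\<dots> \<le> ?w p * ennreal (edge_bound r * exp (\<epsilon> * hgt p) * exp \<beta> / (1 - real K * exp (- \<beta>)) * exp (- \<beta> * hgt p))"
      using way p by (intro mult_left_mono ball_beyond_measure[OF p D_slice r]) auto
    also have "\<dots> = g p * ennreal (exp (- \<epsilon> * hgt p) * (edge_bound r * exp (\<epsilon> * hgt p) * exp \<beta> / (1 - real K * exp (- \<beta>)) * exp (- \<beta> * hgt p)))"
      using geometric_ratio edge_bound_nonneg[of r] r by (subst ennreal_mult) (auto simp: mult.assoc)
    also have "exp (- \<epsilon> * hgt p) * (edge_bound r * exp (\<epsilon> * hgt p) * exp \<beta> / (1 - real K * exp (- \<beta>)) * exp (- \<beta> * hgt p))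
        = (exp (- \<epsilon> * hgt p) * exp (\<epsilon> * hgt p)) * (edge_bound r * exp \<beta> / (1 - real K * exp (- \<beta>))) * exp (- \<beta> * hgt p)"
      by (simp only: mult_ac times_divide_eq_right times_divide_eq_left)
    also have "exp (- \<epsilon> * hgt p) * exp (\<epsilon> * hgt p) = 1" by (simp flip: exp_add)
    also have "1 * (edge_bound r * exp \<beta> / (1 - real K * exp (- \<beta>))) = poincare_const / 2 * r"
      by (simp add: edge_bound_def poincare_const_def)
    also have "g p * ennreal ((poincare_const / 2 * r) * exp (- \<beta> * hgt p)) = ennreal (poincare_const / 2 * r) * (ennreal (exp (- \<beta> * hgt p)) * (g p * indicator ?B p))"
    proof -
      have "ennreal ((poincare_const / 2 * r) * exp (- \<beta> * hgt p)) =
          ennreal (poincare_const / 2 * r) * ennreal (exp (- \<beta> * hgt p))"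
        using poincare_const_pos r by (intro ennreal_mult) auto
      then show ?thesis using True by (simp only: indicator_simps mult_1_right mult_1_left mult_ac)
    qed
    finally show ?thesis .
  qed simp
  have "(\<integral>\<^sup>+y\<in>?B. ennreal \<bar>u y - u z\<bar> \<partial>tmu T \<beta>) \<le> (\<integral>\<^sup>+y. (\<integral>\<^sup>+p. ?w p * indicator ?D (p, y) \<partial>tlength T) \<partial>tmu T \<beta>)"
    using pointwise by (intro nn_integral_tmu_mono) (auto simp: indicator_def)
  also have "\<dots> = (\<integral>\<^sup>+y. ennreal (exp (- \<beta> * hgt y)) * (\<integral>\<^sup>+p. ?w p * indicator ?D (p, y) \<partial>tlength T) \<partial>tlength T)"
    by (rule nn_integral_tmu) measurable
  also have "\<dots> = (\<integral>\<^sup>+y. (\<integral>\<^sup>+p. ennreal (exp (- \<beta> * hgt y)) * (?w p * indicator ?D (p, y)) \<partial>tlength T) \<partial>tlength T)"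
    by (intro nn_integral_cong nn_integral_cmult[symmetric]) measurable
  also have "\<dots> = (\<integral>\<^sup>+p. (\<integral>\<^sup>+y. ennreal (exp (- \<beta> * hgt y)) * (?w p * indicator ?D (p, y)) \<partial>tlength T) \<partial>tlength T)"
    by (rule Fubini') measurable
  also have "\<dots> \<le> (\<integral>\<^sup>+p. ennreal (poincare_const / 2 * r) * (ennreal (exp (- \<beta> * hgt p)) * (g p * indicator ?B p)) \<partial>tlength T)"
    using inner by (intro nn_integral_mono) simp
  also have "\<dots> = ennreal (poincare_const / 2 * r) * (\<integral>\<^sup>+p. ennreal (exp (- \<beta> * hgt p)) * (g p * indicator ?B p) \<partial>tlength T)"
    by (rule nn_integral_cmult) measurable
  also have "(\<integral>\<^sup>+p. ennreal (exp (- \<beta> * hgt p)) * (g p * indicator ?B p) \<partial>tlength T) = (\<integral>\<^sup>+y\<in>?B. g y \<partial>tmu T \<beta>)"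
    by (rule nn_integral_tmu[symmetric]) measurable
  finally show ?thesis by blast
qed

lemma supports_1_Poincare: "supports_1_Poincare T \<epsilon> \<beta>"
  unfolding supports_1_Poincare_def
proof (intro exI[of _ poincare_const] conjI ballI allI impI)
  show "0 < poincare_const" by (rule poincare_const_pos)
  fix x r u g
  assume x: "x \<in> X" and r: "(r::real) > 0" and u: "integrable (tmu T \<beta>) u" and ug: "upper_gradient T \<epsilon> u g"
  let ?B = "tball T \<epsilon> x r" and ?M = "tmu T \<beta>"
  interpret finite_measure ?M by (rule finite_measure_tmu)
  obtain c where c: "(\<integral>\<^sup>+y\<in>?B. ennreal \<bar>u y - c\<bar> \<partial>?M) \<le> ennreal (poincare_const / 2 * r) * (\<integral>\<^sup>+y\<in>?B. g y \<partial>?M)"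
    using deviation_from_top[OF x r ug] by blast
  have "(\<integral>\<^sup>+y\<in>?B. ennreal \<bar>u y - mean_value ?M ?B u\<bar> \<partial>?M) \<le> 2 * (\<integral>\<^sup>+y\<in>?B. ennreal \<bar>u y - c\<bar> \<partial>?M)"
    by (rule mean_value_deviation[OF sets_tmu[OF tball_measurable[OF x]] u])
  also have "\<dots> \<le> 2 * (ennreal (poincare_const / 2 * r) * (\<integral>\<^sup>+y\<in>?B. g y \<partial>?M))"
    by (rule mult_left_mono[OF c]) simp
  also have "\<dots> = ennreal (2 * (poincare_const / 2 * r)) * (\<integral>\<^sup>+y\<in>?B. g y \<partial>?M)"
    by (subst ennreal_mult'') (use poincare_const_pos r in \<open>auto simp: mult.assoc\<close>)
  finally have "(\<integral>\<^sup>+y\<in>?B. ennreal \<bar>u y - mean_value ?M ?B u\<bar> \<partial>?M) \<le> ennreal (poincare_const * r) * (\<integral>\<^sup>+y\<in>?B. g y \<partial>?M)"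
    by simp
  then show "(\<integral>\<^sup>+y\<in>?B. ennreal \<bar>u y - mean_value ?M ?B u\<bar> \<partial>?M) / emeasure ?M ?B
      \<le> ennreal (poincare_const * r) * ((\<integral>\<^sup>+y\<in>?B. g y \<partial>?M) / emeasure ?M ?B)"
    unfolding ennreal_times_divide by (rule divide_right_mono_ennreal)
qed

end

theorem theorem4p2:
  fixes T :: "'v rooted_graph" and K :: nat and \<epsilon> \<beta> :: real
  assumes "K \<ge> 1" and "\<epsilon> > 0" and "\<beta> > ln (real K)"
    and "rooted_tree T"
    and "\<forall>v\<in>verts T. finite (children T v) \<and> card (children T v) \<le> K"
  shows "supports_1_Poincare T \<epsilon> \<beta>"
proof -
  interpret weighted_tree T K \<epsilon> \<beta>
    using assms by unfold_locales auto
  show ?thesis by (rule supports_1_Poincare)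
qed

end
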